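(* Let $M$ be an $n$-dimensional compact Riemannian manifold without boundary with $\mathrm{Ricci}(M)\ge -K$, where $K\ge 0$ is a constant. Let $u=u(x,t)$ be any positive solution of the heat equation $u_t=\Delta u$ on $M$ (for $t>0$), and let $\alpha>1$ be a constant. Then for all $t>0$ (and at every point of $M$), $$|\nabla\log u|^2-\alpha(\log u)_t\le \frac{n\alpha^2}{2}\max\left\{\frac1t,\ \frac{K}{\alpha-1}\right\}.$$
   Context: $\Delta$ is the Laplace--Beltrami operator and $\nabla$ the gradient on $M$ (acting in the space variable); the subscript $t$ denotes the time derivative. $\mathrm{Ricci}(M)\ge -K$ means $\mathrm{Ricci}(X,X)\ge -K|X|^2$ for all tangent vectors $X$. *)

theory Defs
  imports "HOL-Analysis.Analysis"
begin

section \<open>Smooth functions on open sets\<close>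

text \<open>Intended for open \<open>S\<close> and a finite-dimensional domain; there this is the usual class
  \<open>C\<^sup>k\<close> (\<open>C\<^sup>\<infinity>\<close> for \<open>smooth_on\<close>).\<close>

primrec Ck_on :: "nat \<Rightarrow> 'a::real_normed_vector set \<Rightarrow> ('a \<Rightarrow> 'b::real_normed_vector) \<Rightarrow> bool" where
  "Ck_on 0 S f \<longleftrightarrow> continuous_on S f"
| "Ck_on (Suc k) S f \<longleftrightarrow>
     (\<forall>x\<in>S. f differentiable (at x)) \<and>
     (\<forall>v. Ck_on k S (\<lambda>x. frechet_derivative f (at x) v))"

definition smooth_on :: "'a::real_normed_vector set \<Rightarrow> ('a \<Rightarrow> 'b::real_normed_vector) \<Rightarrow> bool" where
  "smooth_on S f \<longleftrightarrow> (\<forall>k. Ck_on k S f)"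

definition partial_deriv :: "'n::finite \<Rightarrow> (real^'n \<Rightarrow> real) \<Rightarrow> real^'n \<Rightarrow> real" where
  "partial_deriv i f y = frechet_derivative f (at y) (axis i 1)"

section \<open>Riemannian geometry in local coordinates\<close>

text \<open>\<open>G y\<close> is the matrix \<open>(g\<^sub>i\<^sub>j(y))\<close> of a metric in coordinates; vectors are given by their
  components with respect to the coordinate frame.\<close>

definition metric_inner :: "(real^'n::finite \<Rightarrow> real^'n^'n) \<Rightarrow> real^'n \<Rightarrow> real^'n \<Rightarrow> real^'n \<Rightarrow> real" where
  "metric_inner G y v w = v \<bullet> (G y *v w)"

text \<open>\<open>christoffel G k i j\<close> is the coefficient with upper index \<open>k\<close> of the Levi-Civita connection:
  the \<open>k\<close>-th component of the covariant derivative of the \<open>j\<close>-th coordinate field along the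
  \<open>i\<close>-th one.\<close>

definition christoffel ::
  "(real^'n::finite \<Rightarrow> real^'n^'n) \<Rightarrow> 'n \<Rightarrow> 'n \<Rightarrow> 'n \<Rightarrow> real^'n \<Rightarrow> real" where
  "christoffel G k i j y =
     (1/2) * (\<Sum>l\<in>UNIV. matrix_inv (G y) $ k $ l *
       (partial_deriv i (\<lambda>z. G z $ j $ l) y + partial_deriv j (\<lambda>z. G z $ i $ l) y
        - partial_deriv l (\<lambda>z. G z $ i $ j) y))"

text \<open>\<open>riemann G l k i j\<close> is the \<open>l\<close>-th component of \<open>R(\<partial>\<^sub>i,\<partial>\<^sub>j)\<partial>\<^sub>k\<close>, where
  \<open>R(X,Y)Z = \<nabla>\<^sub>X\<nabla>\<^sub>YZ - \<nabla>\<^sub>Y\<nabla>\<^sub>XZ - \<nabla>\<^bsub>[X,Y]\<^esub>Z\<close>.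
  The Ricci tensor \<open>Ric(Y,Z)\<close> is the trace of \<open>X \<mapsto> R(X,Y)Z\<close> (positive on round spheres).\<close>

definition riemann ::
  "(real^'n::finite \<Rightarrow> real^'n^'n) \<Rightarrow> 'n \<Rightarrow> 'n \<Rightarrow> 'n \<Rightarrow> 'n \<Rightarrow> real^'n \<Rightarrow> real" where
  "riemann G l k i j y =
     partial_deriv i (christoffel G l j k) y - partial_deriv j (christoffel G l i k) y
     + (\<Sum>m\<in>UNIV. christoffel G m j k y * christoffel G l i m y
                 - christoffel G m i k y * christoffel G l j m y)"

definition ricci :: "(real^'n::finite \<Rightarrow> real^'n^'n) \<Rightarrow> real^'n \<Rightarrow> real^'n \<Rightarrow> real^'n \<Rightarrow> real" where
  "ricci G y v w =
     (\<Sum>j\<in>UNIV. \<Sum>k\<in>UNIV. (\<Sum>i\<in>UNIV. riemann G i k i j y) * v $ j * w $ k)"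

definition grad :: "(real^'n::finite \<Rightarrow> real^'n^'n) \<Rightarrow> (real^'n \<Rightarrow> real) \<Rightarrow> real^'n \<Rightarrow> real^'n" where
  "grad G f y = matrix_inv (G y) *v (\<chi> j. partial_deriv j f y)"

text \<open>The divergence of a vector field is the trace of its covariant derivative.\<close>

definition divergence :: "(real^'n::finite \<Rightarrow> real^'n^'n) \<Rightarrow> (real^'n \<Rightarrow> real^'n) \<Rightarrow> real^'n \<Rightarrow> real" where
  "divergence G V y =
     (\<Sum>i\<in>UNIV. partial_deriv i (\<lambda>z. V z $ i) y + (\<Sum>k\<in>UNIV. christoffel G i i k y * V y $ k))"

definition laplacian :: "(real^'n::finite \<Rightarrow> real^'n^'n) \<Rightarrow> (real^'n \<Rightarrow> real) \<Rightarrow> real^'n \<Rightarrow> real" where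
  "laplacian G f y = divergence G (grad G f) y"

section \<open>Riemannian manifolds\<close>

text \<open>A chart \<open>(U, \<phi>)\<close>; values of \<open>\<phi>\<close> outside the domain \<open>U\<close> are irrelevant.\<close>

type_synonym ('a, 'n) chart = "'a set \<times> ('a \<Rightarrow> real^'n)"

definition chart_image :: "('a, 'n::finite) chart \<Rightarrow> (real^'n) set" where
  "chart_image c = snd c ` fst c"

definition chart_inv :: "('a, 'n::finite) chart \<Rightarrow> real^'n \<Rightarrow> 'a" where
  "chart_inv c = inv_into (fst c) (snd c)"

definition transition :: "('a, 'n::finite) chart \<Rightarrow> ('a, 'n) chart \<Rightarrow> real^'n \<Rightarrow> real^'n" where
  "transition c d = snd d \<circ> chart_inv c"

definition is_chart :: "'a topology \<Rightarrow> ('a, 'n::finite) chart \<Rightarrow> bool" where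
  "is_chart X c \<longleftrightarrow> openin X (fst c) \<and> open (chart_image c) \<and>
     homeomorphic_map (subtopology X (fst c)) (top_of_set (chart_image c)) (snd c)"

text \<open>A smooth manifold without boundary of dimension \<open>CARD('n)\<close>, given by a (not necessarily
  maximal) smooth atlas.\<close>

definition smooth_manifold :: "'a topology \<Rightarrow> ('a, 'n::finite) chart set \<Rightarrow> bool" where
  "smooth_manifold X A \<longleftrightarrow>
     Hausdorff_space X \<and> second_countable X \<and>
     (\<forall>c\<in>A. is_chart X c) \<and> (\<Union>c\<in>A. fst c) = topspace X \<and>
     (\<forall>c\<in>A. \<forall>d\<in>A. smooth_on (snd c ` (fst c \<inter> fst d)) (transition c d))"

text \<open>A Riemannian metric is given by its coordinate matrices \<open>g c\<close> in all charts \<open>c\<close> of the atlas,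
  as functions of the coordinates, subject to the transformation law of covariant 2-tensors.\<close>

definition riemannian_metric ::
  "('a, 'n::finite) chart set \<Rightarrow> (('a, 'n) chart \<Rightarrow> real^'n \<Rightarrow> real^'n^'n) \<Rightarrow> bool" where
  "riemannian_metric A g \<longleftrightarrow>
     (\<forall>c\<in>A. smooth_on (chart_image c) (g c) \<and>
        (\<forall>y\<in>chart_image c. transpose (g c y) = g c y \<and>
           (\<forall>v. v \<noteq> 0 \<longrightarrow> metric_inner (g c) y v v > 0))) \<and>
     (\<forall>c\<in>A. \<forall>d\<in>A. \<forall>y\<in>snd c ` (fst c \<inter> fst d). \<forall>v w.
        metric_inner (g c) y v w =
        metric_inner (g d) (transition c d y)
          (frechet_derivative (transition c d) (at y) v)
          (frechet_derivative (transition c d) (at y) w))"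

definition riemannian_manifold ::
  "'a topology \<Rightarrow> ('a, 'n::finite) chart set \<Rightarrow> (('a, 'n) chart \<Rightarrow> real^'n \<Rightarrow> real^'n^'n) \<Rightarrow> bool" where
  "riemannian_manifold X A g \<longleftrightarrow> smooth_manifold X A \<and> riemannian_metric A g"

definition ricci_bounded_below ::
  "('a, 'n::finite) chart set \<Rightarrow> (('a, 'n) chart \<Rightarrow> real^'n \<Rightarrow> real^'n^'n) \<Rightarrow> real \<Rightarrow> bool" where
  "ricci_bounded_below A g k \<longleftrightarrow>
     (\<forall>c\<in>A. \<forall>y\<in>chart_image c. \<forall>v. ricci (g c) y v v \<ge> k * metric_inner (g c) y v v)"

text \<open>The next two are the values at the point \<open>x\<close> of the Laplace-Beltrami operator and of the
  squared length of the gradient, computed in a chart \<open>c\<close> around \<open>x\<close>. For a twice differentiable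
  function on a Riemannian manifold they do not depend on the choice of \<open>c\<close>.\<close>

definition laplace_beltrami ::
  "(('a, 'n::finite) chart \<Rightarrow> real^'n \<Rightarrow> real^'n^'n) \<Rightarrow> ('a, 'n) chart \<Rightarrow> ('a \<Rightarrow> real) \<Rightarrow> 'a \<Rightarrow> real" where
  "laplace_beltrami g c f x = laplacian (g c) (f \<circ> chart_inv c) (snd c x)"

definition grad_norm_sq ::
  "(('a, 'n::finite) chart \<Rightarrow> real^'n \<Rightarrow> real^'n^'n) \<Rightarrow> ('a, 'n) chart \<Rightarrow> ('a \<Rightarrow> real) \<Rightarrow> 'a \<Rightarrow> real" where
  "grad_norm_sq g c f x =
     (let v = grad (g c) (f \<circ> chart_inv c) (snd c x) in metric_inner (g c) (snd c x) v v)"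

text \<open>Solutions on \<open>M \<times> (0,\<infinity>)\<close>, smooth jointly in space and time; nothing is required as
  \<open>t \<rightarrow> 0\<close>.\<close>

definition heat_solution ::
  "('a, 'n::finite) chart set \<Rightarrow> (('a, 'n) chart \<Rightarrow> real^'n \<Rightarrow> real^'n^'n) \<Rightarrow> ('a \<Rightarrow> real \<Rightarrow> real) \<Rightarrow> bool" where
  "heat_solution A g u \<longleftrightarrow>
     (\<forall>c\<in>A. smooth_on (chart_image c \<times> {0<..}) (\<lambda>(y, t). u (chart_inv c y) t)) \<and>
     (\<forall>c\<in>A. \<forall>x\<in>fst c. \<forall>t>0.
        ((\<lambda>s. u x s) has_real_derivative laplace_beltrami g c (\<lambda>z. u z t) x) (at t))"

end

theory Submission
  imports Defs
begin

text \<open>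
  Put \<open>f = log u\<close>, \<open>Q = |\<nabla>f|\<^sup>2\<close> and \<open>F = Q - \<alpha> f\<^sub>t\<close>. The heat equation becomes \<open>f\<^sub>t = \<Delta>f + Q\<close>, so
  \<open>\<Delta>f = - (F + (\<alpha> - 1) Q) / \<alpha>\<close>. The Bochner formula, in which all terms with \<open>\<nabla>f\<^sub>t\<close> cancel, gives
  \<open>\<Delta>F - F\<^sub>t + 2 \<langle>\<nabla>f, \<nabla>F\<rangle> = 2 |\<nabla>\<nabla>f|\<^sup>2 + 2 Ric(\<nabla>f, \<nabla>f) \<ge> (2/n) (\<Delta>f)\<^sup>2 - 2 K Q\<close>
  (\<open>evolution_of_harnack_quantity\<close>, resting on \<open>bochner\<close> and \<open>trace_power2_le\<close>).

  Fix \<open>\<epsilon> > 0\<close> and maximise \<open>\<theta>(t) F\<close> over \<open>M \<times> [\<epsilon>, T]\<close>, where \<open>\<theta>(t) = min (t - \<epsilon>) \<tau>\<close> and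
  \<open>K \<tau> \<le> \<alpha> - 1\<close>. At a point where this maximum is positive \<open>\<nabla>F = 0\<close>, \<open>\<Delta>F \<le> 0\<close> and \<open>F + (t - \<epsilon>) F\<^sub>t \<ge> 0\<close>. Expanding
  \<open>(\<Delta>f)\<^sup>2 = (F\<^sup>2 + 2 (\<alpha> - 1) F Q + (\<alpha> - 1)\<^sup>2 Q\<^sup>2) / \<alpha>\<^sup>2\<close> shows that \<open>\<theta> F > n \<alpha>\<^sup>2 / 2\<close> is impossible there: the
  first term would exceed \<open>F / \<theta> \<ge> F / (t - \<epsilon>)\<close>, and the cross term would absorb \<open>2 K Q\<close>, because
  \<open>K \<le> (\<alpha> - 1) / \<theta>\<close> (\<open>harnack_at_max\<close> and \<open>weighted_harnack_bound\<close>). Each of the two terms of the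
  maximum in the theorem thus corresponds to one branch of \<open>\<theta>\<close>. The shift by \<open>\<epsilon>\<close> makes \<open>\<theta> F\<close> vanish at
  a positive initial time, where \<open>F\<close> is finite; \<open>\<epsilon>\<close> tends to \<open>0\<close> at the end.

  All differential identities are verified in a single chart, in arbitrary coordinates. The only
  covariance used is that of \<open>|\<nabla>f|\<^sup>2\<close>, which makes \<open>F\<close> a function on \<open>M\<close>
  (\<open>grad_norm_sq_chart_le\<close>); the Laplacian of \<open>F\<close> is only taken in the chart around the maximum.
\<close>

section \<open>Directional derivatives of smooth functions\<close>

definition dd :: "'a::real_normed_vector \<Rightarrow> ('a \<Rightarrow> 'b::real_normed_vector) \<Rightarrow> 'a \<Rightarrow> 'b" where
  "dd v f z = frechet_derivative f (at z) v"

lemma dd_eqI: "(f has_derivative f') (at z) \<Longrightarrow> dd v f z = f' v"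
  by (metis dd_def frechet_derivative_at)

lemma differentiable_has_dd:
  "f differentiable at z \<Longrightarrow> (f has_derivative (\<lambda>v. dd v f z)) (at z)"
  unfolding dd_def frechet_derivative_works .

lemma dd_const [simp]: "dd v (\<lambda>z. c) z = 0"
  by (simp add: dd_def)

lemma dd_cong:
  assumes "open S" "z \<in> S" "\<And>x. x \<in> S \<Longrightarrow> f x = g x"
  shows "dd v f z = dd v g z"
proof (cases "f differentiable at z")
  case True
  then show ?thesis
    unfolding dd_def using frechet_derivative_transform_within_open assms by metis
next
  case False
  have "(f has_derivative D) (at z) \<longleftrightarrow> (g has_derivative D) (at z)" for D
    using has_derivative_transform_within_open[of f D z UNIV S g]
      has_derivative_transform_within_open[of g D z UNIV S f] assms by auto
  then show ?thesis by (simp add: dd_def frechet_derivative_def)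
qed

lemma Ck_on_Suc_dd:
  "Ck_on (Suc k) S f \<longleftrightarrow> (\<forall>x\<in>S. f differentiable (at x)) \<and> (\<forall>v. Ck_on k S (dd v f))"
  by (simp add: dd_def[abs_def])

lemma differentiable_cong_open:
  assumes "open S" "z \<in> S" "\<And>x. x \<in> S \<Longrightarrow> f x = g x" "f differentiable at z"
  shows "g differentiable at z"
  using has_derivative_transform_within_open[of f _ z UNIV S g] assms
  unfolding differentiable_def by blast

lemma Ck_on_cong:
  assumes "open S" "\<And>x. x \<in> S \<Longrightarrow> f x = g x" "Ck_on k S f"
  shows "Ck_on k S g"
  using assms(2,3)
proof (induction k arbitrary: f g)
  case 0
  then show ?case using continuous_on_cong[of S S f g] by simp
next
  case (Suc k)
  have "Ck_on k S (dd v g)" for v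
    using Suc.IH[of "dd v f" "dd v g"] Suc.prems dd_cong[OF assms(1), of _ f g] 
    by (simp add: Ck_on_Suc_dd del: Ck_on.simps)
  then show ?case
    using Suc.prems differentiable_cong_open[OF assms(1), of _ f g]
    by (simp add: Ck_on_Suc_dd del: Ck_on.simps) 
qed

lemma Ck_on_SucD: "Ck_on (Suc k) S f \<Longrightarrow> Ck_on k S f"
proof (induction k arbitrary: f)
  case 0
  then show ?case
    by (auto intro!: differentiable_imp_continuous_on simp: differentiable_on_def differentiable_at_withinI)
next
  case (Suc k)
  then show ?case
    unfolding Ck_on_Suc_dd[of "Suc k"] Ck_on_Suc_dd[of k] by blast
qed

lemma smooth_on_cong:
  "open S \<Longrightarrow> smooth_on S f \<Longrightarrow> (\<And>x. x \<in> S \<Longrightarrow> f x = g x) \<Longrightarrow> smooth_on S g"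
  unfolding smooth_on_def using Ck_on_cong by blast

lemma smooth_on_dd: "smooth_on S f \<Longrightarrow> smooth_on S (dd v f)"
  unfolding smooth_on_def using Ck_on_Suc_dd by blast

lemma smooth_on_has_derivative:
  assumes "smooth_on S f" "z \<in> S"
  shows "(f has_derivative (\<lambda>v. dd v f z)) (at z)"
proof -
  have "Ck_on (Suc 0) S f" using assms by (simp only: smooth_on_def)
  then have "f differentiable at z" using assms by simp
  then show ?thesis by (rule differentiable_has_dd)
qed

lemma smooth_on_continuous_on: "smooth_on S f \<Longrightarrow> continuous_on S f"
  unfolding smooth_on_def using Ck_on.simps(1) by blast

lemma dd_direction_linear:
  assumes "smooth_on S f" "z \<in> S"
  shows "dd (sum F I) f z = (\<Sum>i\<in>I. dd (F i) f z)"
    and "dd (a *\<^sub>R v) f z = a *\<^sub>R dd v f z"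
proof -
  have "linear (\<lambda>v. dd v f z)"
    by (rule has_derivative_linear[OF smooth_on_has_derivative[OF assms]])
  note L = linear_scale[OF this] linear_sum[OF this, unfolded o_def]
  show "dd (sum F I) f z = (\<Sum>i\<in>I. dd (F i) f z)" "dd (a *\<^sub>R v) f z = a *\<^sub>R dd v f z"
    by (simp_all add: L)
qed

text \<open>Closure of the smooth functions under the ring operations is an induction on the order of
  differentiability: the derivative of the result is the same kind of expression one order lower.\<close>

lemma Ck_on_const: "Ck_on k S (\<lambda>z. c)"
  by (induction k arbitrary: c) (simp_all del: Ck_on.simps(2) add: Ck_on_Suc_dd dd_def[abs_def])

lemma Ck_on_add:
  assumes "open S" "Ck_on k S f" "Ck_on k S g"
  shows "Ck_on k S (\<lambda>z. f z + g z)"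
  using assms(2,3)
proof (induction k arbitrary: f g)
  case 0
  then show ?case by (simp add: continuous_on_add)
next
  case (Suc k)
  have "Ck_on k S (dd v (\<lambda>z. f z + g z))" for v
  proof (rule Ck_on_cong[OF assms(1) _ Suc.IH])
    show "dd v f x + dd v g x = dd v (\<lambda>z. f z + g z) x" if "x \<in> S" for x
      by (rule sym, subst dd_eqI[OF has_derivative_add])
        (use Suc.prems that in \<open>auto intro!: differentiable_has_dd\<close>)
    show "Ck_on k S (dd v f)" "Ck_on k S (dd v g)"
      using Suc.prems by (simp_all only: Ck_on_Suc_dd)
  qed
  then show ?case using Suc.prems
    by (auto simp: Ck_on_Suc_dd simp del: Ck_on.simps(2) intro: differentiable_add)
qed

lemma Ck_on_mult:
  fixes f g :: "'a::real_normed_vector \<Rightarrow> real"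
  assumes "open S" "Ck_on k S f" "Ck_on k S g"
  shows "Ck_on k S (\<lambda>z. f z * g z)"
  using assms(2,3)
proof (induction k arbitrary: f g)
  case 0
  then show ?case by (simp add: continuous_on_mult)
next
  case (Suc k)
  have "Ck_on k S (dd v (\<lambda>z. f z * g z))" for v
  proof (rule Ck_on_cong[OF assms(1) _ Ck_on_add[OF assms(1) Suc.IH Suc.IH]])
    show "f x * dd v g x + dd v f x * g x = dd v (\<lambda>z. f z * g z) x" if "x \<in> S" for x
      by (rule sym, subst dd_eqI[OF has_derivative_mult])
        (use Suc.prems that in \<open>auto intro!: differentiable_has_dd\<close>)
    show "Ck_on k S (dd v f)" "Ck_on k S (dd v g)" "Ck_on k S f" "Ck_on k S g"
      using Suc.prems Ck_on_SucD by (simp_all add: Ck_on_Suc_dd del: Ck_on.simps(2)) 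
  qed
  then show ?case using Suc.prems
    by (auto simp: Ck_on_Suc_dd simp del: Ck_on.simps(2) intro: differentiable_mult)
qed

lemma Ck_on_inverse:
  fixes f :: "'a::real_normed_vector \<Rightarrow> real"
  assumes "open S" "\<And>x. x \<in> S \<Longrightarrow> f x \<noteq> 0" "Ck_on k S f"
  shows "Ck_on k S (\<lambda>z. inverse (f z))"
  using assms(3)
proof (induction k)
  case 0
  then show ?case using assms(2) by (simp add: continuous_on_inverse)
next
  case (Suc k)
  have der: "((\<lambda>z. inverse (f z)) has_derivative
      (\<lambda>v. - (inverse (f x) * dd v f x * inverse (f x)))) (at x)" if "x \<in> S" for x
    by (rule Deriv.has_derivative_inverse[of f x, OF assms(2)[OF that] differentiable_has_dd])
      (use Suc.prems that in auto)
  have "Ck_on k S (dd v (\<lambda>z. inverse (f z)))" for v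
  proof (rule Ck_on_cong[OF assms(1) _ Ck_on_mult[OF assms(1) Ck_on_const[of k S "-1"]
          Ck_on_mult[OF assms(1) Ck_on_mult[OF assms(1)]]]])
    show "-1 * (inverse (f x) * dd v f x * inverse (f x)) = dd v (\<lambda>z. inverse (f z)) x"
      if "x \<in> S" for x
      using dd_eqI[OF der[OF that], of v] by simp
    show "Ck_on k S (dd v f)" "Ck_on k S (\<lambda>z. inverse (f z))" "Ck_on k S (\<lambda>z. inverse (f z))"
      using Suc.prems Suc.IH[OF Ck_on_SucD[OF Suc.prems]]
      by (simp_all add: Ck_on_Suc_dd del: Ck_on.simps(2)) 
  qed
  then show ?case using der by (auto simp: Ck_on_Suc_dd differentiable_def simp del: Ck_on.simps(2))
qed

lemma Ck_on_ln:
  fixes f :: "'a::real_normed_vector \<Rightarrow> real"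
  assumes "open S" "\<And>x. x \<in> S \<Longrightarrow> f x > 0" "Ck_on k S f"
  shows "Ck_on k S (\<lambda>z. ln (f z))"
proof (cases k)
  case 0
  then show ?thesis using assms by (force intro!: continuous_intros)
next
  case (Suc m)
  have der: "((\<lambda>z. ln (f z)) has_derivative (\<lambda>v. dd v f x * inverse (f x))) (at x)"
    if "x \<in> S" for x
    using has_derivative_ln[of f x, OF assms(2)[OF that]] assms(3) that Suc
    by (auto simp: differentiable_has_dd divide_inverse)
  have "Ck_on m S (dd v (\<lambda>z. ln (f z)))" for v
  proof (rule Ck_on_cong[OF assms(1) _ Ck_on_mult[OF assms(1) _ Ck_on_inverse[OF assms(1)]]])
    show "dd v f x * inverse (f x) = dd v (\<lambda>z. ln (f z)) x" if "x \<in> S" for x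
      using dd_eqI[OF der[OF that], of v] by simp
    show "Ck_on m S (dd v f)" "Ck_on m S f"
      using assms(3) Ck_on_SucD Suc by (simp_all add: Ck_on_Suc_dd del: Ck_on.simps(2)) 
    show "f x \<noteq> 0" if "x \<in> S" for x using assms(2)[OF that] by simp
  qed
  then show ?thesis using der Suc
    by (auto simp: Ck_on_Suc_dd differentiable_def simp del: Ck_on.simps(2))
qed

lemma smooth_on_const [simp]: "smooth_on S (\<lambda>z. c)"
  by (simp add: smooth_on_def Ck_on_const)

lemma smooth_on_add: "open S \<Longrightarrow> smooth_on S f \<Longrightarrow> smooth_on S g \<Longrightarrow> smooth_on S (\<lambda>z. f z + g z)"
  by (simp add: smooth_on_def Ck_on_add)

lemma smooth_on_mult:
  fixes f g :: "'a::real_normed_vector \<Rightarrow> real"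
  shows "open S \<Longrightarrow> smooth_on S f \<Longrightarrow> smooth_on S g \<Longrightarrow> smooth_on S (\<lambda>z. f z * g z)"
  by (simp add: smooth_on_def Ck_on_mult)

lemma smooth_on_diff:
  fixes f g :: "'a::real_normed_vector \<Rightarrow> real"
  assumes "open S" "smooth_on S f" "smooth_on S g"
  shows "smooth_on S (\<lambda>z. f z - g z)"
  using smooth_on_add[OF assms(1,2) smooth_on_mult[OF assms(1) smooth_on_const[of S "-1"] assms(3)]]
  by simp

lemma smooth_on_inverse:
  fixes f :: "'a::real_normed_vector \<Rightarrow> real"
  shows "open S \<Longrightarrow> smooth_on S f \<Longrightarrow> (\<And>x. x \<in> S \<Longrightarrow> f x \<noteq> 0) \<Longrightarrow> smooth_on S (\<lambda>z. inverse (f z))"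
  by (simp add: smooth_on_def Ck_on_inverse)

lemma smooth_on_ln:
  fixes f :: "'a::real_normed_vector \<Rightarrow> real"
  shows "open S \<Longrightarrow> smooth_on S f \<Longrightarrow> (\<And>x. x \<in> S \<Longrightarrow> f x > 0) \<Longrightarrow> smooth_on S (\<lambda>z. ln (f z))"
  by (simp add: smooth_on_def Ck_on_ln)

lemma smooth_on_sum:
  fixes f :: "'i \<Rightarrow> 'a::real_normed_vector \<Rightarrow> real"
  assumes "open S" "\<And>i. i \<in> I \<Longrightarrow> smooth_on S (f i)"
  shows "smooth_on S (\<lambda>z. \<Sum>i\<in>I. f i z)"
  using assms(2) by (induction I rule: infinite_finite_induct) (auto intro: smooth_on_add assms(1))

lemma smooth_on_prod:
  fixes f :: "'i \<Rightarrow> 'a::real_normed_vector \<Rightarrow> real"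
  assumes "open S" "\<And>i. i \<in> I \<Longrightarrow> smooth_on S (f i)"
  shows "smooth_on S (\<lambda>z. \<Prod>i\<in>I. f i z)"
  using assms(2) by (induction I rule: infinite_finite_induct) (auto intro: smooth_on_mult assms(1))

lemma smooth_on_bounded_linear:
  assumes "open S" "bounded_linear L" "smooth_on S f"
  shows "smooth_on S (\<lambda>z. L (f z))"
proof -
  have "Ck_on k S f \<Longrightarrow> Ck_on k S (\<lambda>z. L (f z))" for k f
  proof (induction k arbitrary: f)
    case 0
    then show ?case using assms(2) by (simp add: bounded_linear.continuous_on)
  next
    case (Suc k)
    have der: "((\<lambda>z. L (f z)) has_derivative (\<lambda>v. L (dd v f x))) (at x)" if "x \<in> S" for x
      by (rule bounded_linear.has_derivative[OF assms(2)])
        (use Suc.prems that in \<open>auto intro!: differentiable_has_dd\<close>)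
    have "Ck_on k S (dd v (\<lambda>z. L (f z)))" for v
    proof (rule Ck_on_cong[OF assms(1) _ Suc.IH])
      show "L (dd v f x) = dd v (\<lambda>z. L (f z)) x" if "x \<in> S" for x
        using dd_eqI[OF der[OF that], of v] by simp
      show "Ck_on k S (dd v f)" using Suc.prems by (simp only: Ck_on_Suc_dd)
    qed
    then show ?case using der by (fastforce simp: Ck_on_Suc_dd differentiable_def simp del: Ck_on.simps(2))
  qed
  then show ?thesis using assms(3) by (simp add: smooth_on_def)
qed

lemma smooth_on_fst:
  fixes f :: "'a::real_normed_vector \<Rightarrow> 'b::real_normed_vector"
    and T :: "'c::real_normed_vector set"
  assumes "open S" "open T" "smooth_on S f"
  shows "smooth_on (S \<times> T) (\<lambda>z. f (fst z))"
proof -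
  have op: "open (S \<times> T)" using assms open_Times by blast
  have "Ck_on k S f \<Longrightarrow> Ck_on k (S \<times> T) (\<lambda>z. f (fst z))" for k and f :: "'a \<Rightarrow> 'b"
  proof (induction k arbitrary: f)
    case 0
    then show ?case by (auto intro: continuous_on_compose2[OF _ continuous_on_fst[OF continuous_on_id]])
  next
    case (Suc k)
    have der: "((\<lambda>z. f (fst z)) has_derivative (\<lambda>v. dd (fst v) f (fst x))) (at x)"
      if "x \<in> S \<times> T" for x
    proof -
      have "(f has_derivative (\<lambda>v. dd v f (fst x))) (at (fst x))"
        using Suc.prems that by (auto intro!: differentiable_has_dd)
      from has_derivative_compose[OF has_derivative_fst[OF has_derivative_ident] this]
      show ?thesis by simp
    qed
    have "Ck_on k (S \<times> T) (dd v (\<lambda>z. f (fst z)))" for v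
    proof (rule Ck_on_cong[OF op _ Suc.IH])
      show "dd (fst v) f (fst x) = dd v (\<lambda>z. f (fst z)) x" if "x \<in> S \<times> T" for x
        using dd_eqI[OF der[OF that], of v] by simp
      show "Ck_on k S (dd (fst v) f)" using Suc.prems by (simp only: Ck_on_Suc_dd)
    qed
    then show ?case using der by (fastforce simp: Ck_on_Suc_dd differentiable_def simp del: Ck_on.simps(2))
  qed
  then show ?thesis using assms(3) by (simp add: smooth_on_def)
qed

lemma dd_add:
  assumes "smooth_on S f" "smooth_on S g" "z \<in> S"
  shows "dd v (\<lambda>z. f z + g z) z = dd v f z + dd v g z"
  by (rule dd_eqI[OF has_derivative_add]) (rule smooth_on_has_derivative assms)+

lemma dd_diff:
  assumes "smooth_on S f" "smooth_on S g" "z \<in> S"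
  shows "dd v (\<lambda>z. f z - g z) z = dd v f z - dd v g z"
  by (rule dd_eqI[OF has_derivative_diff]) (rule smooth_on_has_derivative assms)+

lemma dd_mult:
  fixes f g :: "'a::real_normed_vector \<Rightarrow> real"
  assumes "smooth_on S f" "smooth_on S g" "z \<in> S"
  shows "dd v (\<lambda>z. f z * g z) z = f z * dd v g z + dd v f z * g z"
  by (rule dd_eqI[OF has_derivative_mult]) (rule smooth_on_has_derivative assms)+

lemma dd_cmult:
  fixes f :: "'a::real_normed_vector \<Rightarrow> real"
  assumes "smooth_on S f" "z \<in> S"
  shows "dd v (\<lambda>z. c * f z) z = c * dd v f z"
  using dd_mult[OF smooth_on_const assms, of v c] by simp

lemma dd_sum:
  assumes "\<And>i. i \<in> I \<Longrightarrow> smooth_on S (f i)" "z \<in> S"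
  shows "dd v (\<lambda>z. \<Sum>i\<in>I. f i z) z = (\<Sum>i\<in>I. dd v (f i) z)"
  by (rule dd_eqI[OF has_derivative_sum]) (rule smooth_on_has_derivative assms | assumption)+

lemma dd_ln:
  fixes f :: "'a::real_normed_vector \<Rightarrow> real"
  assumes "smooth_on S f" "z \<in> S" "f z > 0"
  shows "dd v (\<lambda>z. ln (f z)) z = dd v f z * inverse (f z)"
  using dd_eqI[OF has_derivative_ln[OF assms(3) smooth_on_has_derivative[OF assms(1,2)]], of v]
  by (simp add: divide_inverse)

lemma smooth_on_line_derivative:
  fixes f :: "'a::real_normed_vector \<Rightarrow> real"
  assumes "smooth_on S f" "z + x *\<^sub>R v \<in> S"
  shows "((\<lambda>x. f (z + x *\<^sub>R v)) has_real_derivative dd v f (z + x *\<^sub>R v)) (at x)"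
proof -
  have "((\<lambda>x. z + x *\<^sub>R v) has_derivative (\<lambda>h. h *\<^sub>R v)) (at x)"
    by (auto intro!: derivative_eq_intros)
  from has_derivative_compose[OF this smooth_on_has_derivative[OF assms]]
  have "((\<lambda>x. f (z + x *\<^sub>R v)) has_derivative (\<lambda>h. dd (h *\<^sub>R v) f (z + x *\<^sub>R v))) (at x)" .
  then show ?thesis
    by (simp add: dd_direction_linear(2)[OF assms] has_field_derivative_def mult.commute[of _ "dd v f (z + x *\<^sub>R v)"])
qed

text \<open>Two applications of the mean value theorem turn the second difference of \<open>f\<close> along \<open>v\<close> and
  \<open>w\<close> into a mixed derivative at a nearby point.\<close>

lemma second_difference_mean_value:
  fixes f :: "'a::real_normed_vector \<Rightarrow> real"
  assumes f: "smooth_on S f" and s: "s > 0"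
    and inS: "\<And>x y. 0 \<le> x \<Longrightarrow> x \<le> s \<Longrightarrow> 0 \<le> y \<Longrightarrow> y \<le> s \<Longrightarrow> z + x *\<^sub>R v + y *\<^sub>R w \<in> S"
  obtains x y where "0 < x" "x < s" "0 < y" "y < s"
    "f (z + s *\<^sub>R v + s *\<^sub>R w) - f (z + s *\<^sub>R v) - f (z + s *\<^sub>R w) + f z
      = s * s * dd w (dd v f) (z + x *\<^sub>R v + y *\<^sub>R w)"
proof -
  let ?\<psi> = "\<lambda>x. f ((z + s *\<^sub>R w) + x *\<^sub>R v) - f (z + x *\<^sub>R v)"
  have "(?\<psi> has_real_derivative
      dd v f ((z + s *\<^sub>R w) + x *\<^sub>R v) - dd v f (z + x *\<^sub>R v)) (at x)" if "0 \<le> x" "x \<le> s" for x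
    using inS[OF that, of s] inS[OF that, of 0] s
    by (intro DERIV_diff smooth_on_line_derivative[OF f]) (auto simp: algebra_simps)
  from MVT2[OF s this] obtain x where x: "0 < x" "x < s"
    "?\<psi> s - ?\<psi> 0 = s * (dd v f ((z + s *\<^sub>R w) + x *\<^sub>R v) - dd v f (z + x *\<^sub>R v))" by auto
  let ?\<chi> = "\<lambda>y. dd v f ((z + x *\<^sub>R v) + y *\<^sub>R w)"
  have "(?\<chi> has_real_derivative dd w (dd v f) ((z + x *\<^sub>R v) + y *\<^sub>R w)) (at y)"
    if "0 \<le> y" "y \<le> s" for y
    using inS[of x y] x that by (intro smooth_on_line_derivative[OF smooth_on_dd[OF f]]) auto
  from MVT2[OF s this] obtain y where y: "0 < y" "y < s"
    "?\<chi> s - ?\<chi> 0 = s * dd w (dd v f) ((z + x *\<^sub>R v) + y *\<^sub>R w)" by auto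
  show ?thesis
    by (rule that[OF x(1,2) y(1,2)]) (use x(3) y(3) in \<open>simp add: algebra_simps\<close>)
qed

text \<open>The second difference is symmetric in \<open>v\<close> and \<open>w\<close>, so its two expressions as a mixed derivative
  agree at points arbitrarily close to \<open>z\<close>; continuity does the rest.\<close>

lemma dd_commute:
  fixes f :: "'a::real_normed_vector \<Rightarrow> real"
  assumes S: "open S" "z \<in> S" and f: "smooth_on S f"
  shows "dd v (dd w f) z = dd w (dd v f) z"
proof (rule ccontr)
  assume ne: "dd v (dd w f) z \<noteq> dd w (dd v f) z"
  define e where "e = \<bar>dd v (dd w f) z - dd w (dd v f) z\<bar> / 2"
  have e: "e > 0" using ne by (simp add: e_def)
  have near: "\<exists>d>0. \<forall>x. dist x z < d \<longrightarrow> x \<in> S \<and> \<bar>h x - h z\<bar> < e"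
    if "smooth_on S h" for h :: "'a \<Rightarrow> real"
  proof -
    have "isCont h z"
      using smooth_on_continuous_on[OF that] S by (simp add: continuous_on_eq_continuous_at)
    then obtain d1 where d1: "d1 > 0" "\<And>x. dist x z < d1 \<Longrightarrow> \<bar>h x - h z\<bar> < e"
      using e unfolding continuous_at_eps_delta dist_real_def by blast
    obtain d2 where d2: "d2 > 0" "\<And>x. dist x z < d2 \<Longrightarrow> x \<in> S"
      using S open_dist by metis
    show ?thesis using d1 d2 by (intro exI[of _ "min d1 d2"]) auto
  qed
  obtain d1 where d1: "d1 > 0" "\<And>x. dist x z < d1 \<Longrightarrow> x \<in> S \<and> \<bar>dd v (dd w f) x - dd v (dd w f) z\<bar> < e"
    using near[of "dd v (dd w f)"] f smooth_on_dd by metis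
  obtain d2 where d2: "d2 > 0" "\<And>x. dist x z < d2 \<Longrightarrow> x \<in> S \<and> \<bar>dd w (dd v f) x - dd w (dd v f) z\<bar> < e"
    using near[of "dd w (dd v f)"] f smooth_on_dd by metis
  \<comment> \<open>small enough for the parallelogram with sides \<open>s v\<close> and \<open>s w\<close> to lie in both neighbourhoods\<close>
  define s where "s = min d1 d2 / (2 * (norm v + norm w + 1))"
  have pos: "0 < 2 * (norm v + norm w + 1)" by (smt (verit) norm_ge_zero)
  have s: "s > 0" using d1(1) d2(1) pos by (simp add: s_def)
  have close: "dist (z + x *\<^sub>R v + y *\<^sub>R w) z < min d1 d2"
    if "0 \<le> x" "x \<le> s" "0 \<le> y" "y \<le> s" for x y
  proof -
    have "dist (z + x *\<^sub>R v + y *\<^sub>R w) z = norm (x *\<^sub>R v + y *\<^sub>R w)"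
      by (simp add: dist_norm)
    also have "\<dots> \<le> x * norm v + y * norm w"
      using norm_triangle_ineq[of "x *\<^sub>R v" "y *\<^sub>R w"] that by simp
    also have "\<dots> \<le> s * norm v + s * norm w"
      using that by (intro add_mono mult_right_mono) auto
    also have "\<dots> < s * (2 * (norm v + norm w + 1))"
      using s by (simp add: algebra_simps) (smt (verit) norm_ge_zero mult_nonneg_nonneg)
    also have "\<dots> = min d1 d2" using pos by (simp add: s_def)
    finally show ?thesis .
  qed
  obtain x y where 1: "0 < x" "x < s" "0 < y" "y < s"
    "f (z + s *\<^sub>R v + s *\<^sub>R w) - f (z + s *\<^sub>R v) - f (z + s *\<^sub>R w) + f z
      = s * s * dd w (dd v f) (z + x *\<^sub>R v + y *\<^sub>R w)"
    using second_difference_mean_value[OF f s, of z v w] close d1(2) by (metis min_less_iff_conj)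
  obtain x' y' where 2: "0 < x'" "x' < s" "0 < y'" "y' < s"
    "f (z + s *\<^sub>R w + s *\<^sub>R v) - f (z + s *\<^sub>R w) - f (z + s *\<^sub>R v) + f z
      = s * s * dd v (dd w f) (z + x' *\<^sub>R w + y' *\<^sub>R v)"
  proof (rule second_difference_mean_value[OF f s, of z w v])
    show "z + x *\<^sub>R w + y *\<^sub>R v \<in> S" if "0 \<le> x" "x \<le> s" "0 \<le> y" "y \<le> s" for x y
      using close[of y x] d1(2)[of "z + y *\<^sub>R v + x *\<^sub>R w"] that by (simp add: add_ac)
  qed
  have "s * s * dd w (dd v f) (z + x *\<^sub>R v + y *\<^sub>R w) = s * s * dd v (dd w f) (z + x' *\<^sub>R w + y' *\<^sub>R v)"
  proof -
    have "z + s *\<^sub>R w + s *\<^sub>R v = z + s *\<^sub>R v + s *\<^sub>R w" by simp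
    with 1(5) 2(5) show ?thesis by (metis diff_diff_add add.commute)
  qed
  moreover have "z + x' *\<^sub>R w + y' *\<^sub>R v = z + y' *\<^sub>R v + x' *\<^sub>R w" by simp
  ultimately have eq: "dd w (dd v f) (z + x *\<^sub>R v + y *\<^sub>R w) = dd v (dd w f) (z + y' *\<^sub>R v + x' *\<^sub>R w)"
    using s by (metis mult_left_cancel mult_pos_pos less_irrefl)
  have "\<bar>dd w (dd v f) (z + x *\<^sub>R v + y *\<^sub>R w) - dd w (dd v f) z\<bar> < e"
    using d2(2) close[of x y] 1 by auto
  moreover have "\<bar>dd v (dd w f) (z + y' *\<^sub>R v + x' *\<^sub>R w) - dd v (dd w f) z\<bar> < e"
    using d1(2) close[of y' x'] 2 by auto
  moreover have "e + e = \<bar>dd v (dd w f) z - dd w (dd v f) z\<bar>" by (simp add: e_def)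
  ultimately show False using eq by (smt (verit))
qed

text \<open>Functions of space and time: freezing the time turns the derivative along \<open>(v, 0)\<close> into the
  spatial one, and a function of space alone has no time derivative.\<close>

lemma dd_slice:
  assumes "smooth_on S h" "(y, t) \<in> S"
  shows "frechet_derivative (\<lambda>y. h (y, t)) (at y) v = dd (v, 0) h (y, t)"
proof -
  have "((\<lambda>y. (y, t)) has_derivative (\<lambda>v. (v, 0))) (at y)"
    by (auto intro!: derivative_eq_intros)
  from has_derivative_compose[OF this smooth_on_has_derivative[OF assms]]
  show ?thesis by (rule dd_eqI[unfolded dd_def])
qed

lemma dd_time:
  fixes h :: "'a::real_normed_vector \<times> real \<Rightarrow> real"
  assumes "smooth_on S h" "(y, t) \<in> S"
  shows "((\<lambda>s. h (y, s)) has_real_derivative dd (0, 1) h (y, t)) (at t)"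
  using smooth_on_line_derivative[of S h "(y, 0)" t "(0, 1)"] assms by simp

lemma dd_fst:
  assumes "smooth_on S f" "fst z \<in> S"
  shows "dd v (\<lambda>z. f (fst z)) z = dd (fst v) f (fst z)"
  using dd_eqI[OF has_derivative_compose[OF has_derivative_fst[OF has_derivative_ident]
      smooth_on_has_derivative[OF assms]], of v] .

section \<open>Traces of products of symmetric matrices\<close>

lemma sum_delta_mult:
  fixes f :: "'n::finite \<Rightarrow> real"
  shows "(\<Sum>j\<in>UNIV. (if i = j then 1 else 0) * f j) = f i"
    "(\<Sum>j\<in>UNIV. f j * (if j = i then 1 else 0)) = f i"
    "(\<Sum>j\<in>UNIV. (if j = i then 1 else 0) * f j) = f i"
    "(\<Sum>j\<in>UNIV. f j * (if i = j then 1 else 0)) = f i"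
  by (simp_all add: if_distrib[of "\<lambda>c. c * _"] if_distrib[of "\<lambda>c. _ * c"] cong: if_cong)

definition quad_form :: "('n::finite \<Rightarrow> 'n \<Rightarrow> real) \<Rightarrow> ('n \<Rightarrow> real) \<Rightarrow> real" where
  "quad_form M v = (\<Sum>i\<in>UNIV. \<Sum>j\<in>UNIV. v i * M i j * v j)"

lemma quad_form_shift:
  fixes M :: "'n::finite \<Rightarrow> 'n \<Rightarrow> real"
  assumes sym: "\<And>i j. M i j = M j i"
  shows "quad_form M (\<lambda>i. v i + s * (if i = a then 1 else 0))
    = quad_form M v + 2 * s * (\<Sum>j\<in>UNIV. M a j * v j) + s\<^sup>2 * M a a"
proof -
  let ?e = "\<lambda>i. if i = a then 1 else 0 :: real"
  have "quad_form M (\<lambda>i. v i + s * ?e i) =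
    (\<Sum>i\<in>UNIV. \<Sum>j\<in>UNIV. v i * M i j * v j) + s * (\<Sum>i\<in>UNIV. \<Sum>j\<in>UNIV. v i * M i j * ?e j)
    + s * (\<Sum>i\<in>UNIV. ?e i * (\<Sum>j\<in>UNIV. M i j * v j)) + s\<^sup>2 * (\<Sum>i\<in>UNIV. ?e i * (\<Sum>j\<in>UNIV. M i j * ?e j))"
    unfolding quad_form_def sum_distrib_left sum_distrib_right sum.distrib[symmetric]
    by (intro sum.cong refl) (simp add: algebra_simps power2_eq_square)
  also have "(\<Sum>i\<in>UNIV. \<Sum>j\<in>UNIV. v i * M i j * ?e j) = (\<Sum>j\<in>UNIV. M a j * v j)"
    unfolding sum_delta_mult by (intro sum.cong refl) (metis sym mult.commute)
  finally show ?thesis unfolding sum_delta_mult quad_form_def by simp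
qed

text \<open>Gaussian elimination: subtracting the square of one row clears this row and keeps the form
  nonnegative, since the result is the form restricted to the minimum over the cleared variable. A
  vanishing diagonal entry of a nonnegative form forces its row to vanish.\<close>

lemma sum_of_rank_one_squares:
  fixes M :: "'n::finite \<Rightarrow> 'n \<Rightarrow> real"
  assumes "\<And>i j. M i j = M j i" "\<And>v. 0 \<le> quad_form M v"
  obtains r :: "'n \<Rightarrow> 'n \<Rightarrow> real" where "\<And>i j. M i j = (\<Sum>k\<in>UNIV. r k i * r k j)"
proof -
  have "\<exists>r. \<forall>i j. M i j = (\<Sum>k\<in>I. r k i * r k j)"
    if "finite I" "\<And>i j. M i j = M j i" "\<And>v. 0 \<le> quad_form M v" "\<And>i j. i \<notin> I \<Longrightarrow> M i j = 0"
    for I and M :: "'n \<Rightarrow> 'n \<Rightarrow> real"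
    using that
  proof (induction I arbitrary: M rule: finite_induct)
    case empty
    then show ?case by auto
  next
    case (insert a I)
    let ?\<rho> = "\<lambda>v. \<Sum>j\<in>UNIV. M a j * v j"
    have shift: "0 \<le> quad_form M v + 2 * s * ?\<rho> v + s\<^sup>2 * M a a" for v s
      using insert.prems(2)[of "\<lambda>i. v i + s * (if i = a then 1 else 0)"]
      unfolding quad_form_shift[OF insert.prems(1)] .
    \<comment> \<open>for a vanishing pivot nothing is subtracted; the row is then zero already\<close>
    define c where "c = (if M a a = 0 then 0 else 1 / M a a)"
    have Maa: "0 \<le> M a a"
      using shift[of "\<lambda>_. 0" 1] by (simp add: quad_form_def)
    have c: "0 \<le> c" "c * c * M a a = c" using Maa by (simp_all add: c_def)
    have row: "M a j = c * M a a * M a j" for j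
    proof (cases "M a a = 0")
      case True
      let ?e = "\<lambda>i. if i = j then 1 else 0 :: real"
      have \<rho>: "?\<rho> ?e = M a j" by (simp only: sum_delta_mult)
      have le: "0 \<le> quad_form M ?e + s * (2 * M a j)" for s
        using shift[of ?e s] True unfolding \<rho> by (simp add: mult.commute mult.left_commute)
      have "M a j = 0"
      proof (rule ccontr)
        assume "M a j \<noteq> 0"
        then have "- (quad_form M ?e + 1) / (2 * M a j) * (2 * M a j) = - (quad_form M ?e + 1)"
          by simp
        with le[of "- (quad_form M ?e + 1) / (2 * M a j)"] show False by linarith
      qed
      then show ?thesis by simp
    qed (simp add: c_def)
    define M' where "M' i j = M i j - c * (M a i * M a j)" for i j
    have M': "M' i j = M' j i" for i j
      using insert.prems(1)[of i j] by (simp add: M'_def)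
    have q: "quad_form M' v = quad_form M v - c * ?\<rho> v * ?\<rho> v" for v
    proof -
      have "quad_form M' v = quad_form M v - c * (\<Sum>i\<in>UNIV. \<Sum>j\<in>UNIV. (M a i * v i) * (M a j * v j))"
        unfolding quad_form_def M'_def sum_distrib_left sum_subtractf[symmetric]
        by (intro sum.cong refl) (simp add: algebra_simps)
      then show ?thesis by (simp add: sum_product mult.assoc)
    qed
    have "0 \<le> quad_form M' v" for v
    proof -
      have "(- c * ?\<rho> v)\<^sup>2 * M a a = (c * c * M a a) * (?\<rho> v * ?\<rho> v)"
        by (simp only: power2_eq_square mult_minus_left mult_minus_right minus_minus mult_ac)
      with shift[of v "- c * ?\<rho> v"] show ?thesis unfolding q c(2) by simp
    qed
    moreover have "M' i j = 0" if "i \<notin> I" for i j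
    proof (cases "i = a")
      case True
      then show ?thesis using row[of j] by (simp add: M'_def)
    next
      case False
      then have "M i j = 0" "M a i = 0" using insert.prems(1,3) that by (metis insert_iff)+
      then show ?thesis by (simp add: M'_def)
    qed
    ultimately obtain r where r: "\<And>i j. M' i j = (\<Sum>k\<in>I. r k i * r k j)"
      using insert.IH[of M'] M' by blast
    have "M i j = (\<Sum>k\<in>insert a I. (r(a := \<lambda>i. sqrt c * M a i)) k i * (r(a := \<lambda>i. sqrt c * M a i)) k j)" for i j
    proof -
      have "(\<Sum>k\<in>I. (r(a := \<lambda>i. sqrt c * M a i)) k i * (r(a := \<lambda>i. sqrt c * M a i)) k j) = M' i j"
        unfolding r using insert.hyps(2) by (intro sum.cong refl) auto
      moreover have "sqrt c * M a i * (sqrt c * M a j) = c * (M a i * M a j)"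
      proof -
        have "sqrt c * M a i * (sqrt c * M a j) = (sqrt c * sqrt c) * (M a i * M a j)"
          by (simp only: mult_ac)
        then show ?thesis using c(1) by simp
      qed
      ultimately show ?thesis
        using insert.hyps by (simp add: M'_def)
    qed
    then show ?case by blast
  qed
  from this[of UNIV M] assms that show ?thesis by auto
qed

text \<open>With \<open>h = r\<^sup>T r\<close> the trace of \<open>h S h S\<close> is the sum of the squares of the entries of the symmetric
  matrix \<open>w = r S r\<^sup>T\<close>.\<close>

lemma trace_square_nonneg:
  fixes h S :: "'n::finite \<Rightarrow> 'n \<Rightarrow> real"
  assumes "\<And>i j. h i j = h j i" "\<And>v. 0 \<le> quad_form h v" and S: "\<And>i j. S i j = S j i"
  defines "C \<equiv> \<lambda>i j. \<Sum>k\<in>UNIV. h i k * S k j"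
  shows "0 \<le> (\<Sum>i\<in>UNIV. \<Sum>j\<in>UNIV. C i j * C j i)"
proof -
  obtain r :: "'n \<Rightarrow> 'n \<Rightarrow> real" where r: "\<And>i j. h i j = (\<Sum>k\<in>UNIV. r k i * r k j)"
    by (rule sum_of_rank_one_squares[OF assms(1,2)]) blast
  define y where "y p j = (\<Sum>k\<in>UNIV. r p k * S k j)" for p j
  define w where "w p q = (\<Sum>j\<in>UNIV. y p j * r q j)" for p q
  have C: "C i j = (\<Sum>p\<in>UNIV. r p i * y p j)" for i j
    unfolding C_def y_def r sum_distrib_left sum_distrib_right
    by (subst sum.swap) (simp add: mult.assoc)
  have "w p q = (\<Sum>j\<in>UNIV. \<Sum>k\<in>UNIV. r p k * S k j * r q j)" for p q
    unfolding w_def y_def sum_distrib_right ..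
  moreover have "w q p = (\<Sum>j\<in>UNIV. \<Sum>k\<in>UNIV. r p k * S k j * r q j)" for p q
    unfolding w_def y_def sum_distrib_right
    by (subst sum.swap) (intro sum.cong refl, metis S mult.commute mult.left_commute)
  ultimately have w: "w p q = w q p" for p q by simp
  have "(\<Sum>i\<in>UNIV. \<Sum>j\<in>UNIV. C i j * C j i)
    = (\<Sum>i\<in>UNIV. \<Sum>j\<in>UNIV. \<Sum>p\<in>UNIV. \<Sum>q\<in>UNIV. (y p j * r q j) * (y q i * r p i))"
    unfolding C sum_product by (intro sum.cong refl) (simp add: mult_ac)
  also have "\<dots> = (\<Sum>i\<in>UNIV. \<Sum>p\<in>UNIV. \<Sum>q\<in>UNIV. \<Sum>j\<in>UNIV. (y p j * r q j) * (y q i * r p i))"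
    by (rule sum.cong[OF refl], subst sum.swap, rule sum.cong[OF refl], rule sum.swap)
  also have "\<dots> = (\<Sum>p\<in>UNIV. \<Sum>q\<in>UNIV. \<Sum>i\<in>UNIV. \<Sum>j\<in>UNIV. (y p j * r q j) * (y q i * r p i))"
    by (subst sum.swap, rule sum.cong[OF refl], rule sum.swap)
  also have "\<dots> = (\<Sum>p\<in>UNIV. \<Sum>q\<in>UNIV. w p q * w q p)"
    unfolding w_def sum_product
    by (rule sum.cong[OF refl], rule sum.cong[OF refl], rule sum.swap)
  also have "\<dots> \<ge> 0"
  proof (intro sum_nonneg)
    show "0 \<le> w p q * w q p" for p q by (subst w[of q p]) simp
  qed
  finally show ?thesis .
qed

text \<open>The Cauchy-Schwarz inequality \<open>(tr B)\<^sup>2 \<le> n tr(B\<^sup>2)\<close> for an endomorphism \<open>B\<close> that is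
  self-adjoint with respect to the metric \<open>g\<close>: apply the previous lemma to the trace-free part of
  \<open>B\<close>.\<close>

lemma trace_power2_le:
  fixes g h H :: "'n::finite \<Rightarrow> 'n \<Rightarrow> real"
  assumes h: "\<And>i j. h i j = h j i" "\<And>v. 0 \<le> quad_form h v"
    and g: "\<And>i j. g i j = g j i" and hg: "\<And>i k. (\<Sum>j\<in>UNIV. h i j * g j k) = (if i = k then 1 else 0)"
    and H: "\<And>i j. H i j = H j i"
  defines "B \<equiv> \<lambda>i j. \<Sum>k\<in>UNIV. h i k * H k j"
  shows "(\<Sum>i\<in>UNIV. B i i)\<^sup>2 \<le> real CARD('n) * (\<Sum>i\<in>UNIV. \<Sum>j\<in>UNIV. B i j * B j i)"
proof -
  define c where "c = (\<Sum>i\<in>UNIV. B i i) / real CARD('n)"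
  have n: "real CARD('n) > 0" by simp
  have B: "(\<Sum>k\<in>UNIV. h i k * (H k j - c * g k j)) = B i j - c * (if i = j then 1 else 0)" for i j
    unfolding B_def hg[symmetric] sum_distrib_left sum_subtractf[symmetric]
    by (intro sum.cong refl) (simp add: algebra_simps)
  have "0 \<le> (\<Sum>i\<in>UNIV. \<Sum>j\<in>UNIV. (B i j - c * (if i = j then 1 else 0)) * (B j i - c * (if j = i then 1 else 0)))"
    using trace_square_nonneg[OF h, of "\<lambda>k j. H k j - c * g k j"] g H unfolding B by simp
  also have "\<dots> = (\<Sum>i\<in>UNIV. \<Sum>j\<in>UNIV. B i j * B j i) - 2 * c * (\<Sum>i\<in>UNIV. \<Sum>j\<in>UNIV. B i j * (if i = j then 1 else 0))
      + c\<^sup>2 * (\<Sum>i\<in>UNIV. \<Sum>j\<in>(UNIV::'n set). 1 * (if i = j then 1 else 0))"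
    unfolding sum_distrib_left sum_subtractf[symmetric] sum.distrib[symmetric]
    by (intro sum.cong refl) (auto simp: algebra_simps power2_eq_square)
  also have "\<dots> = (\<Sum>i\<in>UNIV. \<Sum>j\<in>UNIV. B i j * B j i) - 2 * c * (\<Sum>i\<in>UNIV. B i i) + c\<^sup>2 * real CARD('n)"
    unfolding sum_delta_mult by simp
  finally have "0 \<le> real CARD('n) * ((\<Sum>i\<in>UNIV. \<Sum>j\<in>UNIV. B i j * B j i) - 2 * c * (\<Sum>i\<in>UNIV. B i i) + c\<^sup>2 * real CARD('n))"
    using n by (simp add: zero_le_mult_iff)
  then show ?thesis using n by (simp add: c_def algebra_simps power2_eq_square)
qed

section \<open>The Bochner formula in coordinates\<close>

lemma sum_swap23:
  "(\<Sum>i\<in>A. \<Sum>j\<in>B. \<Sum>k\<in>C. F i j k) = (\<Sum>i\<in>A. \<Sum>k\<in>C. \<Sum>j\<in>B. F i j k)"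
  by (rule sum.cong[OF refl], rule sum.swap)

text \<open>The index computation behind \<open>\<nabla>\<^sub>l (V\<^sup>i \<nabla>\<^sub>i V\<^sup>l) = \<nabla>\<^sub>l V\<^sup>i \<nabla>\<^sub>i V\<^sup>l + V\<^sup>i \<nabla>\<^sub>i \<nabla>\<^sub>l V\<^sup>l + Ric(V, V)\<close> at one point,
  isolated from all analysis: \<open>v\<close> stands for the field, \<open>d\<close> and \<open>D\<close> for its first and second
  derivatives (\<open>d i l\<close> and \<open>D m i l\<close> differentiate the component \<open>l\<close>), \<open>\<gamma>\<close> for the Christoffel symbols,
  and \<open>\<delta> m\<close> for their derivative in the direction \<open>m\<close>. Both sides are expanded into monomial sums,
  which are then matched by renaming summation indices.\<close>

lemma contracted_ricci_algebra:
  fixes v :: "'n::finite \<Rightarrow> real" and d :: "'n \<Rightarrow> 'n \<Rightarrow> real" and D \<gamma> :: "'n \<Rightarrow> 'n \<Rightarrow> 'n \<Rightarrow> real"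
    and \<delta> :: "'n \<Rightarrow> 'n \<Rightarrow> 'n \<Rightarrow> 'n \<Rightarrow> real"
  assumes D: "\<And>l i m. D l i m = D i l m" and \<gamma>: "\<And>l i k. \<gamma> l i k = \<gamma> l k i"
  defines "c \<equiv> \<lambda>l i. d i l + (\<Sum>k\<in>UNIV. \<gamma> l i k * v k)"
  shows "(\<Sum>l\<in>UNIV. (\<Sum>i\<in>UNIV. v i * (D l i l + (\<Sum>k\<in>UNIV. \<gamma> l i k * d l k + \<delta> l l i k * v k)) + d l i * c l i)
           + (\<Sum>k\<in>UNIV. \<gamma> l l k * (\<Sum>i\<in>UNIV. v i * c k i)))
    = (\<Sum>l\<in>UNIV. \<Sum>i\<in>UNIV. c l i * c i l)
      + (\<Sum>i\<in>UNIV. v i * (\<Sum>l\<in>UNIV. D i l l + (\<Sum>k\<in>UNIV. \<gamma> l l k * d i k + \<delta> i l l k * v k)))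
      + (\<Sum>j\<in>UNIV. \<Sum>k\<in>UNIV. (\<Sum>i\<in>UNIV. \<delta> i i j k - \<delta> j i i k
            + (\<Sum>m\<in>UNIV. \<gamma> m j k * \<gamma> i i m - \<gamma> m i k * \<gamma> i j m)) * v j * v k)"
    (is "?L = ?A + ?B + ?R")
proof -
  have c: "c l i = d i l + (\<Sum>k\<in>UNIV. \<gamma> l i k * v k)" for l i by (simp add: c_def)
  let ?s2 = "\<lambda>F::'n \<Rightarrow> 'n \<Rightarrow> real. \<Sum>l\<in>UNIV. \<Sum>i\<in>UNIV. F l i"
  let ?s3 = "\<lambda>F::'n \<Rightarrow> 'n \<Rightarrow> 'n \<Rightarrow> real. \<Sum>l\<in>UNIV. \<Sum>i\<in>UNIV. \<Sum>k\<in>UNIV. F l i k"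
  let ?s4 = "\<lambda>F::'n \<Rightarrow> 'n \<Rightarrow> 'n \<Rightarrow> 'n \<Rightarrow> real. \<Sum>l\<in>UNIV. \<Sum>i\<in>UNIV. \<Sum>k\<in>UNIV. \<Sum>m\<in>UNIV. F l i k m"
  have s2: "?s2 F = ?s2 (\<lambda>i l. F l i)" for F by (rule sum.swap)
  have s3: "?s3 F = ?s3 (\<lambda>i l k. F l i k)" "?s3 F = ?s3 (\<lambda>l k i. F l i k)" for F
    by (rule sum.swap) (rule sum_swap23)
  have s4: "?s4 F = ?s4 (\<lambda>i l k m. F l i k m)" "?s4 F = ?s4 (\<lambda>l k i m. F l i k m)"
     "?s4 F = ?s4 (\<lambda>l i m k. F l i k m)" for F
      apply (rule sum.swap)
     apply (rule sum_swap23)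
    apply (rule sum.cong[OF refl], rule sum_swap23)
    done
  have L: "?L = ?s2 (\<lambda>l i. v i * D l i l) + ?s3 (\<lambda>l i k. v i * \<gamma> l i k * d l k)
      + ?s3 (\<lambda>l i k. v i * \<delta> l l i k * v k) + ?s2 (\<lambda>l i. d l i * c l i)
      + ?s3 (\<lambda>l k i. \<gamma> l l k * v i * d i k) + ?s4 (\<lambda>l k i m. \<gamma> l l k * v i * \<gamma> k i m * v m)"
    unfolding c_def
    by (simp add: sum_distrib_left sum_distrib_right sum.distrib distrib_left mult.assoc)
  have A: "?A = ?s2 (\<lambda>l i. d l i * c l i) + ?s3 (\<lambda>l i k. d i l * \<gamma> i l k * v k)
      + ?s4 (\<lambda>l i k m. \<gamma> l i m * v m * \<gamma> i l k * v k)"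
  proof -
    have "?A = ?s2 (\<lambda>l i. d l i * c l i + (\<Sum>k\<in>UNIV. d i l * \<gamma> i l k * v k)
        + (\<Sum>k\<in>UNIV. \<Sum>m\<in>UNIV. \<gamma> l i m * v m * \<gamma> i l k * v k))"
    proof (intro sum.cong refl)
      fix l i
      have "c l i * c i l = d l i * c l i + c l i * (\<Sum>k\<in>UNIV. \<gamma> i l k * v k)"
        by (subst (2) c) (simp add: algebra_simps)
      also have "c l i * (\<Sum>k\<in>UNIV. \<gamma> i l k * v k) = (\<Sum>k\<in>UNIV. d i l * \<gamma> i l k * v k)
        + (\<Sum>k\<in>UNIV. \<Sum>m\<in>UNIV. \<gamma> l i m * v m * \<gamma> i l k * v k)"
        unfolding c_def distrib_right sum_distrib_left sum_distrib_right
        by (simp add: sum.distrib mult.assoc)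
      finally show "c l i * c i l = d l i * c l i + (\<Sum>k\<in>UNIV. d i l * \<gamma> i l k * v k)
        + (\<Sum>k\<in>UNIV. \<Sum>m\<in>UNIV. \<gamma> l i m * v m * \<gamma> i l k * v k)" by simp
    qed
    then show ?thesis by (simp add: sum.distrib)
  qed
  have B: "?B = ?s2 (\<lambda>i l. v i * D i l l) + ?s3 (\<lambda>i l k. v i * \<gamma> l l k * d i k)
      + ?s3 (\<lambda>i l k. v i * \<delta> i l l k * v k)"
    by (simp add: sum_distrib_left sum.distrib distrib_left mult.assoc)
  have R: "?R = ?s3 (\<lambda>j k i. \<delta> i i j k * v j * v k) - ?s3 (\<lambda>j k i. \<delta> j i i k * v j * v k)
     + ?s4 (\<lambda>j k i m. \<gamma> m j k * \<gamma> i i m * v j * v k) - ?s4 (\<lambda>j k i m. \<gamma> m i k * \<gamma> i j m * v j * v k)"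
    by (simp add: sum_distrib_left sum_distrib_right sum.distrib sum_subtractf algebra_simps)
  have 1: "?s2 (\<lambda>l i. v i * D l i l) = ?s2 (\<lambda>i l. v i * D i l l)"
    by (subst s2) (simp add: D)
  have 2: "?s3 (\<lambda>l i k. v i * \<delta> l l i k * v k) = ?s3 (\<lambda>j k i. \<delta> i i j k * v j * v k)"
    by (subst s3(1), subst s3(2)) (simp add: mult_ac)
  have 3: "?s3 (\<lambda>i l k. v i * \<delta> i l l k * v k) = ?s3 (\<lambda>j k i. \<delta> j i i k * v j * v k)"
    by (subst s3(2)) (simp add: mult_ac)
  have 4: "?s3 (\<lambda>l k i. \<gamma> l l k * v i * d i k) = ?s3 (\<lambda>i l k. v i * \<gamma> l l k * d i k)"
    by (subst s3(2), subst s3(1)) (simp add: mult_ac)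
  have 5: "?s4 (\<lambda>l k i m. \<gamma> l l k * v i * \<gamma> k i m * v m) = ?s4 (\<lambda>j k i m. \<gamma> m j k * \<gamma> i i m * v j * v k)"
  proof -
    have "?s4 (\<lambda>l k i m. \<gamma> l l k * v i * \<gamma> k i m * v m) = ?s4 (\<lambda>l i k m. \<gamma> l l k * v i * \<gamma> k i m * v m)"
      by (rule s4(2))
    also have "\<dots> = ?s4 (\<lambda>i l k m. \<gamma> l l k * v i * \<gamma> k i m * v m)" by (rule s4(1))
    also have "\<dots> = ?s4 (\<lambda>i l m k. \<gamma> l l k * v i * \<gamma> k i m * v m)" by (rule s4(3))
    also have "\<dots> = ?s4 (\<lambda>i m l k. \<gamma> l l k * v i * \<gamma> k i m * v m)" by (rule s4(2))
    finally show ?thesis by (simp add: mult_ac)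
  qed
  have 6: "?s3 (\<lambda>l i k. v i * \<gamma> l i k * d l k) = ?s3 (\<lambda>l i k. d i l * \<gamma> i l k * v k)"
  proof -
    have "?s3 (\<lambda>l i k. v i * \<gamma> l i k * d l k) = ?s3 (\<lambda>l k i. v i * \<gamma> l k i * d l k)"
      by (subst s3(2)) (simp add: \<gamma>)
    also have "\<dots> = ?s3 (\<lambda>k l i. v i * \<gamma> l k i * d l k)" by (rule s3(1))
    finally show ?thesis by (simp add: mult_ac)
  qed
  have 7: "?s4 (\<lambda>l i k m. \<gamma> l i m * v m * \<gamma> i l k * v k) = ?s4 (\<lambda>j k i m. \<gamma> m i k * \<gamma> i j m * v j * v k)"
  proof -
    have "?s4 (\<lambda>l i k m. \<gamma> l i m * v m * \<gamma> i l k * v k) = ?s4 (\<lambda>l i k m. \<gamma> l i m * \<gamma> i k l * v k * v m)"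
      by (intro sum.cong refl) (simp add: \<gamma>[of _ _ k for k] mult_ac)
    also have "\<dots> = ?s4 (\<lambda>l k i m. \<gamma> l i m * \<gamma> i k l * v k * v m)" by (rule s4(2))
    also have "\<dots> = ?s4 (\<lambda>k l i m. \<gamma> l i m * \<gamma> i k l * v k * v m)" by (rule s4(1))
    also have "\<dots> = ?s4 (\<lambda>k l m i. \<gamma> l i m * \<gamma> i k l * v k * v m)" by (rule s4(3))
    also have "\<dots> = ?s4 (\<lambda>k m l i. \<gamma> l i m * \<gamma> i k l * v k * v m)" by (rule s4(2))
    also have "\<dots> = ?s4 (\<lambda>k m i l. \<gamma> l i m * \<gamma> i k l * v k * v m)" by (rule s4(3))
    finally show ?thesis .
  qed
  show ?thesis unfolding L A B R 1 2 3 4 5 6 7 by simp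
qed

text \<open>The metric is given by its coefficients \<open>g\<close> and those of its inverse \<open>h\<close>, as functions on an
  open set \<open>S\<close> of a vector space which may have further directions besides the coordinate
  directions \<open>b\<close>. This allows time-dependent functions to be treated with the same operators.\<close>

locale coordinate_metric =
  fixes S :: "'a::real_normed_vector set" and b :: "'n::finite \<Rightarrow> 'a"
    and g h :: "'n \<Rightarrow> 'n \<Rightarrow> 'a \<Rightarrow> real"
  assumes S: "open S"
    and g: "smooth_on S (g i j)" and h: "smooth_on S (h i j)"
    and g_sym: "z \<in> S \<Longrightarrow> g i j z = g j i z" and h_sym: "z \<in> S \<Longrightarrow> h i j z = h j i z"
    and h_g: "z \<in> S \<Longrightarrow> (\<Sum>j\<in>UNIV. h i j z * g j k z) = (if i = k then 1 else 0)"
begin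

abbreviation P :: "'n \<Rightarrow> ('a \<Rightarrow> real) \<Rightarrow> 'a \<Rightarrow> real" where
  "P i \<equiv> dd (b i)"

text \<open>Christoffel symbols of the first kind.\<close>

definition Gam1 :: "'n \<Rightarrow> 'n \<Rightarrow> 'n \<Rightarrow> 'a \<Rightarrow> real" where
  "Gam1 c i j z = 1/2 * (P i (g j c) z + P j (g i c) z - P c (g i j) z)"

definition Gam :: "'n \<Rightarrow> 'n \<Rightarrow> 'n \<Rightarrow> 'a \<Rightarrow> real" where
  "Gam k i j z = (\<Sum>l\<in>UNIV. h k l z * Gam1 l i j z)"

text \<open>\<open>cov V l i\<close> is the component \<open>l\<close> of the covariant derivative of \<open>V\<close> in the direction \<open>i\<close>, and
  \<open>dv\<close> below is its trace, the divergence.\<close>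

definition cov :: "('n \<Rightarrow> 'a \<Rightarrow> real) \<Rightarrow> 'n \<Rightarrow> 'n \<Rightarrow> 'a \<Rightarrow> real" where
  "cov V l i z = P i (V l) z + (\<Sum>k\<in>UNIV. Gam l i k z * V k z)"

definition dv :: "('n \<Rightarrow> 'a \<Rightarrow> real) \<Rightarrow> 'a \<Rightarrow> real" where
  "dv V z = (\<Sum>i\<in>UNIV. cov V i i z)"

definition grd :: "('a \<Rightarrow> real) \<Rightarrow> 'n \<Rightarrow> 'a \<Rightarrow> real" where
  "grd f i z = (\<Sum>j\<in>UNIV. h i j z * P j f z)"

definition lap :: "('a \<Rightarrow> real) \<Rightarrow> 'a \<Rightarrow> real" where
  "lap f = dv (grd f)"

definition nsq :: "('a \<Rightarrow> real) \<Rightarrow> 'a \<Rightarrow> real" where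
  "nsq f z = (\<Sum>i\<in>UNIV. P i f z * grd f i z)"

definition hess :: "('a \<Rightarrow> real) \<Rightarrow> 'n \<Rightarrow> 'n \<Rightarrow> 'a \<Rightarrow> real" where
  "hess f i j z = P j (P i f) z - (\<Sum>m\<in>UNIV. Gam m i j z * P m f z)"

definition ric :: "('n \<Rightarrow> real) \<Rightarrow> 'a \<Rightarrow> real" where
  "ric v z = (\<Sum>j\<in>UNIV. \<Sum>k\<in>UNIV. (\<Sum>i\<in>UNIV. P i (Gam i j k) z - P j (Gam i i k) z
      + (\<Sum>m\<in>UNIV. Gam m j k z * Gam i i m z - Gam m i k z * Gam i j m z)) * v j * v k)"

lemmas smooth_arith = smooth_on_add[OF S] smooth_on_mult[OF S] smooth_on_diff[OF S]
  smooth_on_sum[OF S] smooth_on_dd smooth_on_const g h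

lemma smooth_Gam1: "smooth_on S (Gam1 c i j)"
  unfolding Gam1_def[abs_def] by (intro smooth_arith)

lemma smooth_Gam: "smooth_on S (Gam k i j)"
  unfolding Gam_def[abs_def] by (intro smooth_arith smooth_Gam1)

lemma smooth_grd: "smooth_on S f \<Longrightarrow> smooth_on S (grd f i)"
  unfolding grd_def[abs_def] by (intro smooth_arith)

lemma smooth_cov: "(\<And>i. smooth_on S (V i)) \<Longrightarrow> smooth_on S (cov V l i)"
  unfolding cov_def[abs_def] by (intro smooth_arith smooth_Gam)

lemma smooth_dv: "(\<And>i. smooth_on S (V i)) \<Longrightarrow> smooth_on S (dv V)"
  unfolding dv_def[abs_def] by (intro smooth_arith smooth_cov)

lemma smooth_lap: "smooth_on S f \<Longrightarrow> smooth_on S (lap f)"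
  unfolding lap_def by (intro smooth_dv smooth_grd)

lemma smooth_nsq: "smooth_on S f \<Longrightarrow> smooth_on S (nsq f)"
  unfolding nsq_def[abs_def] by (intro smooth_arith smooth_grd)

lemma P_g_sym: "z \<in> S \<Longrightarrow> P c (g i j) z = P c (g j i) z"
  by (rule dd_cong[OF S]) (simp_all add: g_sym)

lemma Gam1_sym: "z \<in> S \<Longrightarrow> Gam1 c i j z = Gam1 c j i z"
  by (simp add: Gam1_def P_g_sym[of z c i j])

lemma Gam_sym: "z \<in> S \<Longrightarrow> Gam k i j z = Gam k j i z"
  by (simp add: Gam_def Gam1_sym[of z _ i j])

lemma Gam1_add: "z \<in> S \<Longrightarrow> Gam1 a k j z + Gam1 k a j z = P j (g k a) z"
  by (simp add: Gam1_def P_g_sym[of z _ j] P_g_sym[of z _ a k] field_simps)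

lemma g_h: "z \<in> S \<Longrightarrow> (\<Sum>j\<in>UNIV. g i j z * h j k z) = (if i = k then 1 else 0)"
  using h_g[of z k i] by (simp add: g_sym[of z i] h_sym[of z k] mult.commute eq_commute)

text \<open>Differentiate \<open>h g = 1\<close>.\<close>

lemma P_h:
  assumes z: "z \<in> S"
  shows "P j (h l m) z = - (\<Sum>a\<in>UNIV. \<Sum>k\<in>UNIV. h l a z * P j (g a k) z * h k m z)"
proof -
  have "(\<Sum>a\<in>UNIV. P j (h l a) z * g a k z) = - (\<Sum>a\<in>UNIV. h l a z * P j (g a k) z)" for k
  proof -
    have "0 = P j (\<lambda>z. \<Sum>a\<in>UNIV. h l a z * g a k z) z"
      using dd_cong[OF S z, of "\<lambda>z. \<Sum>a\<in>UNIV. h l a z * g a k z" "\<lambda>_. if l = k then 1 else 0" "b j"] h_g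
      by simp
    also have "\<dots> = (\<Sum>a\<in>UNIV. h l a z * P j (g a k) z + P j (h l a) z * g a k z)"
      by (subst dd_sum[OF smooth_arith(2)[OF h g] z]) (simp add: dd_mult[OF h g z])
    finally show ?thesis by (simp add: sum.distrib)
  qed
  then have "(\<Sum>k\<in>UNIV. (\<Sum>a\<in>UNIV. P j (h l a) z * g a k z) * h k m z)
    = - (\<Sum>k\<in>UNIV. (\<Sum>a\<in>UNIV. h l a z * P j (g a k) z) * h k m z)"
    by (simp add: sum_negf)
  moreover have "(\<Sum>k\<in>UNIV. (\<Sum>a\<in>UNIV. P j (h l a) z * g a k z) * h k m z) =
    (\<Sum>a\<in>UNIV. P j (h l a) z * (\<Sum>k\<in>UNIV. g a k z * h k m z))"
    unfolding sum_distrib_right sum_distrib_left by (subst sum.swap) (simp add: mult.assoc)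
  moreover have "\<dots> = P j (h l m) z" unfolding g_h[OF z] sum_delta_mult ..
  moreover have "(\<Sum>k\<in>UNIV. (\<Sum>a\<in>UNIV. h l a z * P j (g a k) z) * h k m z)
      = (\<Sum>a\<in>UNIV. \<Sum>k\<in>UNIV. h l a z * P j (g a k) z * h k m z)"
    unfolding sum_distrib_right by (rule sum.swap)
  ultimately show ?thesis by simp
qed

text \<open>The inverse metric is parallel, because the symmetrised Christoffel symbols of the first kind are
  derivatives of \<open>g\<close>.\<close>

lemma P_h_Gam:
  assumes z: "z \<in> S"
  shows "P j (h l m) z = - (\<Sum>k\<in>UNIV. Gam l j k z * h k m z) - (\<Sum>a\<in>UNIV. h l a z * Gam m a j z)"
proof -
  have 1: "(\<Sum>k\<in>UNIV. Gam l j k z * h k m z) = (\<Sum>a\<in>UNIV. \<Sum>k\<in>UNIV. h l a z * Gam1 a k j z * h k m z)"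
    unfolding Gam_def sum_distrib_right by (subst sum.swap) (simp add: Gam1_sym[OF z, of _ j])
  have 2: "(\<Sum>a\<in>UNIV. h l a z * Gam m a j z) = (\<Sum>a\<in>UNIV. \<Sum>k\<in>UNIV. h l a z * Gam1 k a j z * h k m z)"
    unfolding Gam_def sum_distrib_left by (simp add: h_sym[OF z, of m] mult_ac)
  have "P j (h l m) z = - (\<Sum>a\<in>UNIV. \<Sum>k\<in>UNIV. h l a z * (Gam1 a k j z + Gam1 k a j z) * h k m z)"
    unfolding P_h[OF z] Gam1_add[OF z] by (simp add: P_g_sym[OF z])
  then show ?thesis unfolding 1 2 by (simp add: algebra_simps sum.distrib)
qed

lemma hess_sym: "z \<in> S \<Longrightarrow> smooth_on S f \<Longrightarrow> hess f i j z = hess f j i z"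
  by (simp add: hess_def dd_commute[OF S, of z f "b i"] Gam_sym[of z _ i])

lemma P_grd:
  assumes z: "z \<in> S" and f: "smooth_on S f"
  shows "P j (grd f l) z = (\<Sum>i\<in>UNIV. h l i z * P j (P i f) z + P j (h l i) z * P i f z)"
  unfolding grd_def[abs_def]
  by (subst dd_sum[OF smooth_arith(2)[OF h smooth_on_dd[OF f]] z])
    (simp add: dd_mult[OF h smooth_on_dd[OF f] z])

text \<open>Since the inverse metric is parallel, raising an index commutes with covariant differentiation.\<close>

lemma cov_grd:
  assumes z: "z \<in> S" and f: "smooth_on S f"
  shows "cov (grd f) l j z = (\<Sum>i\<in>UNIV. h l i z * hess f i j z)"
proof -
  have 1: "(\<Sum>k\<in>UNIV. Gam l j k z * grd f k z) = (\<Sum>i\<in>UNIV. (\<Sum>k\<in>UNIV. Gam l j k z * h k i z) * P i f z)"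
    unfolding grd_def sum_distrib_left sum_distrib_right by (subst sum.swap) (simp add: mult.assoc)
  have 2: "(\<Sum>i\<in>UNIV. (\<Sum>a\<in>UNIV. h l a z * Gam i a j z) * P i f z)
    = (\<Sum>a\<in>UNIV. h l a z * (\<Sum>i\<in>UNIV. Gam i a j z * P i f z))"
    unfolding sum_distrib_left sum_distrib_right by (subst sum.swap) (simp add: mult.assoc)
  have "cov (grd f) l j z = (\<Sum>i\<in>UNIV. h l i z * P j (P i f) z)
    - (\<Sum>i\<in>UNIV. (\<Sum>a\<in>UNIV. h l a z * Gam i a j z) * P i f z)"
    unfolding cov_def P_grd[OF z f] 1 P_h_Gam[OF z]
    by (simp add: sum.distrib sum_subtractf algebra_simps sum_negf)
  also have "\<dots> = (\<Sum>i\<in>UNIV. h l i z * hess f i j z)"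
    unfolding 2 hess_def by (simp add: sum_subtractf algebra_simps)
  finally show ?thesis .
qed

lemma P_nsq:
  assumes z: "z \<in> S" and f: "smooth_on S f"
  shows "P k (nsq f) z = 2 * (\<Sum>j\<in>UNIV. hess f k j z * grd f j z)"
proof -
  have grd: "P k (grd f i) z = (\<Sum>a\<in>UNIV. h i a z * hess f a k z) - (\<Sum>m\<in>UNIV. Gam i k m z * grd f m z)" for i
    using cov_grd[OF z f, of i k] by (simp add: cov_def)
  have "P k (nsq f) z = (\<Sum>i\<in>UNIV. P i f z * P k (grd f i) z + P k (P i f) z * grd f i z)"
    unfolding nsq_def[abs_def]
    by (subst dd_sum[OF smooth_arith(2)[OF smooth_on_dd[OF f] smooth_grd[OF f]] z])
      (simp add: dd_mult[OF smooth_on_dd[OF f] smooth_grd[OF f] z])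
  also have "\<dots> = (\<Sum>i\<in>UNIV. P i f z * (\<Sum>a\<in>UNIV. h i a z * hess f a k z))
     - (\<Sum>i\<in>UNIV. P i f z * (\<Sum>m\<in>UNIV. Gam i k m z * grd f m z)) + (\<Sum>i\<in>UNIV. P k (P i f) z * grd f i z)"
    unfolding grd by (simp add: sum.distrib sum_subtractf algebra_simps)
  also have "(\<Sum>i\<in>UNIV. P i f z * (\<Sum>a\<in>UNIV. h i a z * hess f a k z)) = (\<Sum>a\<in>UNIV. hess f k a z * grd f a z)"
    unfolding grd_def sum_distrib_left
    by (subst sum.swap) (simp add: h_sym[OF z, of _ a for a] hess_sym[OF z f, of k] mult_ac)
  also have "(\<Sum>i\<in>UNIV. P i f z * (\<Sum>m\<in>UNIV. Gam i k m z * grd f m z)) =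
      (\<Sum>m\<in>UNIV. (\<Sum>i\<in>UNIV. Gam i k m z * P i f z) * grd f m z)"
    unfolding sum_distrib_left sum_distrib_right by (subst sum.swap) (simp add: mult_ac)
  also have "(\<Sum>a\<in>UNIV. hess f k a z * grd f a z) - (\<Sum>m\<in>UNIV. (\<Sum>i\<in>UNIV. Gam i k m z * P i f z) * grd f m z)
     + (\<Sum>i\<in>UNIV. P k (P i f) z * grd f i z)
     = (\<Sum>a\<in>UNIV. hess f k a z * grd f a z) + (\<Sum>a\<in>UNIV. hess f a k z * grd f a z)"
    unfolding hess_def[of f _ k] by (simp add: sum_subtractf algebra_simps Gam_sym[OF z, of _ k])
  finally show ?thesis by (simp add: hess_sym[OF z f, of _ k])
qed

text \<open>Half the gradient of the squared length of \<open>V = grad f\<close> is the derivative of \<open>V\<close> along itself,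
  because the Hessian is symmetric.\<close>

lemma grd_nsq:
  assumes z: "z \<in> S" and f: "smooth_on S f"
  shows "grd (nsq f) l z = 2 * (\<Sum>j\<in>UNIV. grd f j z * cov (grd f) l j z)"
proof -
  have "grd (nsq f) l z = (\<Sum>k\<in>UNIV. \<Sum>j\<in>UNIV. 2 * (h l k z * (hess f k j z * grd f j z)))"
    unfolding grd_def[of "nsq f"] P_nsq[OF z f] by (simp add: sum_distrib_left mult_ac)
  also have "\<dots> = 2 * (\<Sum>j\<in>UNIV. grd f j z * cov (grd f) l j z)"
    unfolding cov_grd[OF z f] sum_distrib_left by (subst sum.swap) (simp add: mult_ac)
  finally show ?thesis .
qed

text \<open>Commuting the two covariant derivatives in the divergence of the field \<open>D\<^sub>V V\<close> produces the
  Ricci curvature, for every vector field \<open>V\<close>. Torsion freeness enters as the symmetry of \<open>Gam\<close>, and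
  the symmetry of second derivatives as \<open>dd_commute\<close>.\<close>

lemma dv_cov_self:
  assumes z: "z \<in> S" and V: "\<And>i. smooth_on S (V i)"
  shows "dv (\<lambda>l z. \<Sum>i\<in>UNIV. V i z * cov V l i z) z =
    (\<Sum>l\<in>UNIV. \<Sum>i\<in>UNIV. cov V l i z * cov V i l z) + (\<Sum>i\<in>UNIV. V i z * P i (dv V) z) + ric (\<lambda>i. V i z) z"
proof -
  have Pcov: "P m (cov V l i) z = P m (P i (V l)) z
      + (\<Sum>k\<in>UNIV. Gam l i k z * P m (V k) z + P m (Gam l i k) z * V k z)" for m l i
    unfolding cov_def[abs_def]
    by (simp add: dd_add[OF smooth_on_dd[OF V] smooth_arith(4)[OF smooth_arith(2)[OF smooth_Gam V]] z]
        dd_sum[OF smooth_arith(2)[OF smooth_Gam V] z] dd_mult[OF smooth_Gam V z])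
  have PW: "P m (\<lambda>z. \<Sum>i\<in>UNIV. V i z * cov V l i z) z
     = (\<Sum>i\<in>UNIV. V i z * P m (cov V l i) z + P m (V i) z * cov V l i z)" for m l
    by (simp add: dd_sum[OF smooth_arith(2)[OF V smooth_cov[OF V]] z] dd_mult[OF V smooth_cov[OF V] z])
  have Pdv: "P m (dv V) z = (\<Sum>l\<in>UNIV. P m (cov V l l) z)" for m
    unfolding dv_def[abs_def] by (simp add: dd_sum[OF smooth_cov[OF V] z])
  have "P l (P i (V m)) z = P i (P l (V m)) z" for l i m
    by (rule dd_commute[OF S z V])
  from contracted_ricci_algebra[OF this Gam_sym[OF z], where v = "\<lambda>i. V i z" and d = "\<lambda>i l. P i (V l) z"
      and \<delta> = "\<lambda>m l i k. P m (Gam l i k) z"]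
  show ?thesis
    unfolding dv_def[of "\<lambda>l z. \<Sum>i\<in>UNIV. V i z * cov V l i z"] Pdv Pcov ric_def
      cov_def[of "\<lambda>l z. \<Sum>i\<in>UNIV. V i z * cov V l i z"] PW
    by (simp only: cov_def)
qed

lemma dv_scale_cong:
  assumes "z \<in> S" "\<And>i. smooth_on S (V i)" "\<And>i z. z \<in> S \<Longrightarrow> W i z = c * V i z"
  shows "dv W z = c * dv V z"
proof -
  have "P i (W i) z = c * P i (V i) z" for i
    using dd_cong[OF S assms(1), of "W i" "\<lambda>z. c * V i z" "b i"] assms dd_cmult[OF assms(2,1)] by metis
  then show ?thesis
    unfolding dv_def cov_def sum_distrib_left
    by (intro sum.cong refl) (simp add: assms sum_distrib_left algebra_simps)
qed

text \<open>Half the gradient of \<open>|V|\<^sup>2\<close> is \<open>D\<^sub>V V\<close> for \<open>V = grad f\<close>, and the divergence of the latter has just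
  been computed.\<close>

theorem bochner:
  assumes z: "z \<in> S" and f: "smooth_on S f"
  shows "lap (nsq f) z = 2 * (\<Sum>l\<in>UNIV. \<Sum>i\<in>UNIV. cov (grd f) l i z * cov (grd f) i l z)
    + 2 * (\<Sum>i\<in>UNIV. grd f i z * P i (lap f) z) + 2 * ric (\<lambda>i. grd f i z) z"
proof -
  have "lap (nsq f) z = 2 * dv (\<lambda>l z. \<Sum>i\<in>UNIV. grd f i z * cov (grd f) l i z) z"
    unfolding lap_def
    by (rule dv_scale_cong[OF z])
      (intro smooth_arith smooth_cov smooth_grd f, rule grd_nsq[OF _ f])
  then show ?thesis
    unfolding dv_cov_self[OF z smooth_grd[OF f]] lap_def by simp
qed

end

section \<open>Positive solutions of the heat equation\<close>

text \<open>A positive second derivative at a critical point would make the first derivative positive to the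
  right of it.\<close>

lemma second_derivative_le_zero_at_max:
  fixes f :: "real \<Rightarrow> real"
  assumes f: "\<And>x. \<bar>x\<bar> < d \<Longrightarrow> (f has_real_derivative f' x) (at x)"
    and f': "(f' has_real_derivative l) (at 0)" and d: "d > 0"
    and max: "\<And>x. \<bar>x\<bar> < d \<Longrightarrow> f x \<le> f 0"
  shows "f' 0 = 0" "l \<le> 0"
proof -
  show 0: "f' 0 = 0"
    using DERIV_local_max[OF f[of 0] d] max d by simp
  show "l \<le> 0"
  proof (rule ccontr)
    assume "\<not> l \<le> 0"
    then obtain e where e: "e > 0" "\<And>x. 0 < x \<Longrightarrow> x < e \<Longrightarrow> f' 0 < f' (0 + x)"
      using DERIV_pos_inc_right[OF f'] by auto
    define x where "x = min d e / 2"
    have x: "0 < x" "x < d" "x < e" using d e(1) by (auto simp: x_def)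
    obtain y where y: "0 < y" "y < x" "f x - f 0 = (x - 0) * f' y"
      using MVT2[OF x(1), of f f'] f x by auto
    then have "f' y > 0" using e(2)[of y] x 0 by simp
    then have "f x - f 0 > 0" using y(3) x(1) by simp
    then show False using max[of x] x by simp
  qed
qed

context coordinate_metric
begin

text \<open>At a critical point the Laplacian is the trace of the coordinate Hessian against \<open>h\<close>. Writing \<open>h\<close>
  as a sum of rank one squares turns it into a sum of second derivatives along lines.\<close>

lemma local_max_lap_le_zero:
  assumes z: "z \<in> S" and F: "smooth_on S F" and psd: "\<And>v. 0 \<le> quad_form (\<lambda>i j. h i j z) v"
    and max: "\<And>r. \<exists>d>0. \<forall>x. \<bar>x\<bar> < d \<longrightarrow>
      z + x *\<^sub>R (\<Sum>i\<in>UNIV. r i *\<^sub>R b i) \<in> S \<and> F (z + x *\<^sub>R (\<Sum>i\<in>UNIV. r i *\<^sub>R b i)) \<le> F z"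
  shows "P i F z = 0" "lap F z \<le> 0"
proof -
  let ?v = "\<lambda>r. \<Sum>i\<in>UNIV. r i *\<^sub>R b i"
  have along: "dd (?v r) F z = 0" "dd (?v r) (dd (?v r) F) z \<le> 0" for r
  proof -
    obtain d where d: "d > 0" "\<And>x. \<bar>x\<bar> < d \<Longrightarrow> z + x *\<^sub>R ?v r \<in> S"
      "\<And>x. \<bar>x\<bar> < d \<Longrightarrow> F (z + x *\<^sub>R ?v r) \<le> F z"
      using max[of r] by blast
    have "((\<lambda>x. dd (?v r) F (z + x *\<^sub>R ?v r)) has_real_derivative dd (?v r) (dd (?v r) F) (z + 0 *\<^sub>R ?v r)) (at 0)"
      by (rule smooth_on_line_derivative[OF smooth_on_dd[OF F]]) (use z in simp)
    from second_derivative_le_zero_at_max[OF smooth_on_line_derivative[OF F d(2)] this d(1)] d(3)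
    show "dd (?v r) F z = 0" "dd (?v r) (dd (?v r) F) z \<le> 0" by simp_all
  qed
  have dd_v: "dd (?v r) f z = (\<Sum>i\<in>UNIV. r i * P i f z)" if "smooth_on S f" "z \<in> S" for r f z
    by (simp add: dd_direction_linear[OF that])
  show P0: "P i F z = 0" for i
    using along(1)[of "\<lambda>j. if j = i then 1 else 0"] by (simp only: dd_v[OF F z] sum_delta_mult)
  obtain r :: "'n \<Rightarrow> 'n \<Rightarrow> real" where r: "\<And>i j. h i j z = (\<Sum>k\<in>UNIV. r k i * r k j)"
    by (rule sum_of_rank_one_squares[OF h_sym[OF z] psd]) blast
  have "dd (?v (r k)) (dd (?v (r k)) F) z = (\<Sum>i\<in>UNIV. \<Sum>j\<in>UNIV. r k i * r k j * P i (P j F) z)" for k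
  proof -
    have "P i (dd (?v (r k)) F) z = (\<Sum>j\<in>UNIV. r k j * P i (P j F) z)" for i
    proof -
      have "P i (dd (?v (r k)) F) z = P i (\<lambda>z. \<Sum>j\<in>UNIV. r k j * P j F z) z"
        by (rule dd_cong[OF S z]) (rule dd_v[OF F])
      also have "\<dots> = (\<Sum>j\<in>UNIV. r k j * P i (P j F) z)"
        by (simp add: dd_sum[OF smooth_arith(2)[OF smooth_on_const smooth_on_dd[OF F]] z]
            dd_cmult[OF smooth_on_dd[OF F] z])
      finally show ?thesis .
    qed
    then show ?thesis
      unfolding dd_v[OF smooth_on_dd[OF F] z] by (simp add: sum_distrib_left mult.assoc)
  qed
  then have "(\<Sum>k\<in>UNIV. dd (?v (r k)) (dd (?v (r k)) F) z)
      = (\<Sum>i\<in>UNIV. \<Sum>j\<in>UNIV. h i j z * P i (P j F) z)"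
    unfolding r sum_distrib_right
    by simp (subst sum.swap, rule sum.cong[OF refl], rule sum.swap)
  moreover have "lap F z = (\<Sum>i\<in>UNIV. \<Sum>j\<in>UNIV. h i j z * P i (P j F) z)"
    unfolding lap_def dv_def cov_def P_grd[OF z F] grd_def by (simp add: P0)
  ultimately have "lap F z = (\<Sum>k\<in>UNIV. dd (?v (r k)) (dd (?v (r k)) F) z)" by simp
  then show "lap F z \<le> 0" by (simp add: along(2) sum_nonpos)
qed

lemma lap_diff:
  assumes z: "z \<in> S" and f: "smooth_on S f" and k: "smooth_on S k"
  shows "lap (\<lambda>z. f z - c * k z) z = lap f z - c * lap k z"
    and "P i (\<lambda>z. f z - c * k z) z = P i f z - c * P i k z"
proof -
  have P: "P i (\<lambda>z. f z - c * k z) z = P i f z - c * P i k z"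
    if "z \<in> S" "smooth_on S f" "smooth_on S k" for i z f k
    using that by (simp add: dd_diff[OF that(2) smooth_arith(2)[OF smooth_on_const that(3)] that(1)]
       dd_cmult[OF that(3,1)])
  then show "P i (\<lambda>z. f z - c * k z) z = P i f z - c * P i k z" using assms .
  have grd: "grd (\<lambda>z. f z - c * k z) i z = grd f i z - c * grd k i z" if "z \<in> S" for i z
    unfolding grd_def P[OF that f k] by (simp add: sum_subtractf sum_distrib_left algebra_simps)
  have Pgrd: "P i (grd (\<lambda>z. f z - c * k z) i) z = P i (grd f i) z - c * P i (grd k i) z" for i
    using dd_cong[OF S z, of "grd (\<lambda>z. f z - c * k z) i", OF grd, where v = "b i"]
      P[OF z smooth_grd[OF f] smooth_grd[OF k]] by simp
  show "lap (\<lambda>z. f z - c * k z) z = lap f z - c * lap k z"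
    unfolding lap_def dv_def cov_def Pgrd grd[OF z]
    by (simp add: sum_subtractf sum_distrib_left sum.distrib algebra_simps)
qed

text \<open>Differentiate \<open>\<nabla>u = u \<nabla>f\<close>. For a positive solution of the heat equation this gives
  \<open>f\<^sub>t = \<Delta>f + |\<nabla>f|\<^sup>2\<close>.\<close>

lemma lap_ln:
  assumes z: "z \<in> S" and u: "smooth_on S u" and pos: "\<And>z. z \<in> S \<Longrightarrow> u z > 0"
  defines "f \<equiv> \<lambda>z. ln (u z)"
  shows "lap u z = u z * (lap f z + nsq f z)"
proof -
  have f: "smooth_on S f" unfolding f_def by (rule smooth_on_ln[OF S u pos])
  have Pu: "P i u z = u z * P i f z" if "z \<in> S" for i z
    unfolding f_def dd_ln[OF u that pos[OF that]] using pos[OF that] by simp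
  have grd: "grd u i z = u z * grd f i z" if "z \<in> S" for i z
    unfolding grd_def Pu[OF that] by (simp add: sum_distrib_left mult_ac)
  have "P i (grd u i) z = u z * P i (grd f i) z + u z * (P i f z * grd f i z)" for i
    using dd_cong[OF S z, OF grd, of _ "b i"] dd_mult[OF u smooth_grd[OF f] z, of "b i" i] Pu[OF z, of i]
    by simp
  then show ?thesis
    unfolding lap_def dv_def cov_def nsq_def distrib_left sum_distrib_left
    by (simp add: grd[OF z] sum.distrib sum_distrib_left algebra_simps)
qed

end

text \<open>The direction \<open>e\<close> is that of time. As the metric does not change along \<open>e\<close>, the derivative along
  \<open>e\<close> commutes with all spatial operators.\<close>

locale static_metric = coordinate_metric S b g h
  for S :: "'a::real_normed_vector set" and b :: "'n::finite \<Rightarrow> 'a"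
    and g h :: "'n \<Rightarrow> 'n \<Rightarrow> 'a \<Rightarrow> real" +
  fixes e :: 'a
  assumes static: "z \<in> S \<Longrightarrow> dd e (g i j) z = 0" "z \<in> S \<Longrightarrow> dd e (h i j) z = 0"
begin

lemma time_P:
  assumes "z \<in> S" "smooth_on S f"
  shows "dd e (P i f) z = P i (dd e f) z"
  by (rule dd_commute[OF S assms])

lemma time_P_g: "z \<in> S \<Longrightarrow> dd e (P k (g i j)) z = 0"
  using time_P[OF _ g, of z k i j] dd_cong[OF S, of z "dd e (g i j)" "\<lambda>_. 0" "b k"] static(1)
  by simp

lemma time_Gam:
  assumes z: "z \<in> S"
  shows "dd e (Gam k i j) z = 0"
proof -
  have "dd e (Gam1 c i j) z = 0" for c
    unfolding Gam1_def[abs_def]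
    by (subst dd_cmult[OF smooth_arith(3)[OF smooth_arith(1)] z], (rule smooth_arith)+,
       subst dd_diff[OF smooth_arith(1) _ z], (rule smooth_arith)+,
       subst dd_add[OF _ _ z], (rule smooth_arith)+) (simp add: time_P_g[OF z])
  then show ?thesis
    unfolding Gam_def[abs_def]
    by (simp add: dd_sum[OF smooth_arith(2)[OF h smooth_Gam1] z] dd_mult[OF h smooth_Gam1 z] static(2)[OF z])
qed

lemma time_grd:
  assumes z: "z \<in> S" and f: "smooth_on S f"
  shows "dd e (grd f i) z = grd (dd e f) i z"
  unfolding grd_def[abs_def]
  by (simp add: dd_sum[OF smooth_arith(2)[OF h smooth_on_dd[OF f]] z] dd_mult[OF h smooth_on_dd[OF f] z]
      static(2)[OF z] time_P[OF z f])

lemma time_nsq: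
  assumes z: "z \<in> S" and f: "smooth_on S f"
  shows "dd e (nsq f) z = 2 * (\<Sum>i\<in>UNIV. grd f i z * P i (dd e f) z)"
proof -
  have "dd e (nsq f) z = (\<Sum>i\<in>UNIV. P i f z * grd (dd e f) i z) + (\<Sum>i\<in>UNIV. grd f i z * P i (dd e f) z)"
    unfolding nsq_def[abs_def]
    by (simp add: dd_sum[OF smooth_arith(2)[OF smooth_on_dd[OF f] smooth_grd[OF f]] z]
        dd_mult[OF smooth_on_dd[OF f] smooth_grd[OF f] z] time_grd[OF z f] time_P[OF z f] sum.distrib mult.commute)
  also have "(\<Sum>i\<in>UNIV. P i f z * grd (dd e f) i z) = (\<Sum>i\<in>UNIV. grd f i z * P i (dd e f) z)"
    unfolding grd_def sum_distrib_left sum_distrib_right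
    by (subst sum.swap) (simp add: h_sym[OF z, of _ i for i] mult_ac)
  finally show ?thesis by simp
qed

lemma time_lap:
  assumes z: "z \<in> S" and f: "smooth_on S f"
  shows "dd e (lap f) z = lap (dd e f) z"
proof -
  have "dd e (P i (grd f l)) z = P i (grd (dd e f) l) z" for i l
    unfolding time_P[OF z smooth_grd[OF f]] by (rule dd_cong[OF S z]) (rule time_grd[OF _ f])
  then have "dd e (cov (grd f) l i) z = cov (grd (dd e f)) l i z" for l i
    unfolding cov_def[abs_def]
    by (simp add: dd_add[OF smooth_on_dd[OF smooth_grd[OF f]]
          smooth_arith(4)[OF smooth_arith(2)[OF smooth_Gam smooth_grd[OF f]]] z]
        dd_sum[OF smooth_arith(2)[OF smooth_Gam smooth_grd[OF f]] z] dd_mult[OF smooth_Gam smooth_grd[OF f] z]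
        time_Gam[OF z] time_grd[OF z f])
  then show ?thesis
    unfolding lap_def dv_def[abs_def] by (simp add: dd_sum[OF smooth_cov[OF smooth_grd[OF f]] z])
qed

text \<open>The Bochner formula contains \<open>\<nabla>\<Delta>f = \<nabla>f\<^sub>t - \<nabla>Q\<close>. The terms with \<open>\<nabla>Q\<close> are absorbed by the transport
  term \<open>2 \<langle>\<nabla>f, \<nabla>F\<rangle>\<close>, those with \<open>\<nabla>f\<^sub>t\<close> cancel against \<open>F\<^sub>t\<close> and the rest of
  the transport term.\<close>

lemma evolution_of_harnack_quantity:
  fixes \<alpha> :: real
  assumes z: "z \<in> S" and f: "smooth_on S f"
    and eq: "\<And>z. z \<in> S \<Longrightarrow> dd e f z = lap f z + nsq f z"
  defines "F \<equiv> \<lambda>z. nsq f z - \<alpha> * dd e f z"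
  shows "lap F z - dd e F z + 2 * (\<Sum>i\<in>UNIV. grd f i z * P i F z) =
    2 * (\<Sum>l\<in>UNIV. \<Sum>i\<in>UNIV. cov (grd f) l i z * cov (grd f) i l z) + 2 * ric (\<lambda>i. grd f i z) z"
proof -
  let ?T = "dd e f"
  have T: "smooth_on S ?T" by (rule smooth_on_dd[OF f])
  note Q = smooth_nsq[OF f]
  have lapF: "lap F z = lap (nsq f) z - \<alpha> * lap ?T z" unfolding F_def by (rule lap_diff[OF z Q T])
  have PF: "P i F z = P i (nsq f) z - \<alpha> * P i ?T z" for i unfolding F_def by (rule lap_diff[OF z Q T])
  have TF: "dd e F z = dd e (nsq f) z - \<alpha> * dd e ?T z"
    unfolding F_def
    by (simp add: dd_diff[OF Q smooth_arith(2)[OF smooth_on_const T] z] dd_cmult[OF T z])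
  have TT: "dd e ?T z = lap ?T z + dd e (nsq f) z"
    using dd_cong[OF S z, OF eq, where v = e] dd_add[OF smooth_lap[OF f] Q z, of e] time_lap[OF z f] by simp
  have Plap: "P i (lap f) z = P i ?T z - P i (nsq f) z" for i
    using dd_cong[OF S z, OF eq, where v = "b i"] dd_add[OF smooth_lap[OF f] Q z, of "b i"] by simp
  have A: "(\<Sum>i\<in>UNIV. grd f i z * P i F z)
    = (\<Sum>i\<in>UNIV. grd f i z * P i (nsq f) z) - \<alpha> * (\<Sum>i\<in>UNIV. grd f i z * P i ?T z)"
    unfolding PF by (simp add: sum_subtractf sum_distrib_left algebra_simps)
  have B: "(\<Sum>i\<in>UNIV. grd f i z * P i (lap f) z)
    = (\<Sum>i\<in>UNIV. grd f i z * P i ?T z) - (\<Sum>i\<in>UNIV. grd f i z * P i (nsq f) z)"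
    unfolding Plap by (simp add: sum_subtractf algebra_simps)
  have alg: "2 * x + 2 * (p - q) + 2 * r - \<alpha> * l - (2 * p - \<alpha> * (l + 2 * p)) + 2 * (q - \<alpha> * p)
      = 2 * x + 2 * r" for x p q r l :: real by (simp add: algebra_simps)
  show ?thesis
    unfolding lapF TF TT A bochner[OF z f] B time_nsq[OF z f] by (rule alg)
qed

text \<open>This is the maximum principle argument at a single point. With \<open>Q = |\<nabla>f|\<^sup>2\<close> one has
  \<open>\<Delta>f = - (F + (\<alpha> - 1) Q) / \<alpha>\<close>. If \<open>\<theta> F > n \<alpha>\<^sup>2 / 2\<close>, the cross term of \<open>(2/n) (\<Delta>f)\<^sup>2\<close> dominates the
  curvature term \<open>2 K Q\<close>, as \<open>K \<theta> \<le> \<alpha> - 1\<close>, and its term \<open>2 F\<^sup>2 / (n \<alpha>\<^sup>2)\<close> exceeds \<open>F / \<theta>\<close>, while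
  \<open>- F\<^sub>t \<le> F / s \<le> F / \<theta>\<close>.\<close>

lemma harnack_at_max:
  fixes \<alpha> K \<theta> s :: real
  assumes z: "z \<in> S" and f: "smooth_on S f"
    and eq: "\<And>z. z \<in> S \<Longrightarrow> dd e f z = lap f z + nsq f z"
    and psd: "\<And>v. 0 \<le> quad_form (\<lambda>i j. h i j z) v"
    and ric: "ric (\<lambda>i. grd f i z) z \<ge> - K * nsq f z"
    and \<alpha>: "\<alpha> > 1" and K: "K \<ge> 0" and \<theta>: "0 < \<theta>" "\<theta> \<le> s" "K * \<theta> \<le> \<alpha> - 1"
  defines "F \<equiv> \<lambda>z. nsq f z - \<alpha> * dd e f z"
  assumes PF: "\<And>i. P i F z = 0" and lapF: "lap F z \<le> 0" and TF: "F z + s * dd e F z \<ge> 0"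
  shows "\<theta> * F z \<le> real CARD('n) * \<alpha>\<^sup>2 / 2"
proof (rule ccontr)
  define n where "n = real CARD('n)"
  define Q where "Q = nsq f z"
  define L where "L = lap f z"
  define \<phi> where "\<phi> = F z"
  assume "\<not> ?thesis"
  then have big: "\<theta> * \<phi> > n * \<alpha>\<^sup>2 / 2" by (simp add: n_def \<phi>_def)
  have n: "n > 0" by (simp add: n_def)
  have Q: "Q \<ge> 0" using psd[of "\<lambda>i. P i f z"]
    by (simp add: Q_def nsq_def grd_def quad_form_def sum_distrib_left mult_ac)
  have \<phi>0: "\<phi> > 0"
  proof -
    have "0 < n * \<alpha>\<^sup>2 / 2" using n \<alpha> by simp
    with big have "0 < \<theta> * \<phi>" by linarith
    then show ?thesis using \<theta>(1) by (simp add: zero_less_mult_iff)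
  qed
  have L: "\<alpha> * L = - (\<phi> + (\<alpha> - 1) * Q)"
    using eq[OF z] by (simp add: \<phi>_def F_def L_def Q_def algebra_simps)
  have tr: "L\<^sup>2 \<le> n * (\<Sum>l\<in>UNIV. \<Sum>i\<in>UNIV. cov (grd f) l i z * cov (grd f) i l z)"
    unfolding L_def n_def lap_def dv_def cov_grd[OF z f]
    by (rule trace_power2_le[where g = "\<lambda>i j. g i j z"])
      (rule h_sym[OF z] psd g_sym[OF z] h_g[OF z] hess_sym[OF z f])+
  have ev: "- dd e F z \<ge> 2 * (\<Sum>l\<in>UNIV. \<Sum>i\<in>UNIV. cov (grd f) l i z * cov (grd f) i l z) - 2 * K * Q"
    using evolution_of_harnack_quantity[OF z f eq, of \<alpha>, folded F_def] PF lapF ric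
    by (simp add: Q_def)
  have "2 * (\<phi> + (\<alpha> - 1) * Q)\<^sup>2 = 2 * \<alpha>\<^sup>2 * L\<^sup>2"
  proof -
    have "(\<alpha> * L)\<^sup>2 = (\<phi> + (\<alpha> - 1) * Q)\<^sup>2" unfolding L by (rule power2_minus)
    then show ?thesis by (simp add: power_mult_distrib)
  qed
  also have "\<dots> \<le> 2 * \<alpha>\<^sup>2 * (n * (\<Sum>l\<in>UNIV. \<Sum>i\<in>UNIV. cov (grd f) l i z * cov (grd f) i l z))"
    using tr by (intro mult_left_mono) auto
  also have "\<dots> \<le> \<alpha>\<^sup>2 * n * (2 * K * Q - dd e F z)"
    using ev n mult_left_mono[of "2 * (\<Sum>l\<in>UNIV. \<Sum>i\<in>UNIV. cov (grd f) l i z * cov (grd f) i l z)"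
        "2 * K * Q - dd e F z" "\<alpha>\<^sup>2 * n"] by (simp add: mult.assoc mult.left_commute)
  finally have 1: "\<theta> * (2 * (\<phi> + (\<alpha> - 1) * Q)\<^sup>2) \<le> \<theta> * (\<alpha>\<^sup>2 * n * (2 * K * Q - dd e F z))"
    using \<theta> by (intro mult_left_mono) auto
  \<comment> \<open>only \<open>\<theta> \<le> s\<close> is known, so the sign of the time derivative matters\<close>
  have "- \<theta> * dd e F z \<le> \<phi>"
  proof (cases "dd e F z \<ge> 0")
    case True
    then have "\<theta> * dd e F z \<ge> 0" using \<theta> by simp
    then show ?thesis using \<phi>0 by linarith
  next
    case False
    then have "\<theta> * (- dd e F z) \<le> s * (- dd e F z)" using \<theta> by (intro mult_right_mono) auto
    then show ?thesis using TF by (simp add: \<phi>_def)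
  qed
  moreover have "2 * (K * \<theta>) * Q \<le> 2 * (\<alpha> - 1) * Q" using \<theta>(3) Q by (intro mult_right_mono) auto
  ultimately have "\<theta> * (2 * K * Q - dd e F z) \<le> \<phi> + 2 * (\<alpha> - 1) * Q"
    by (simp add: algebra_simps)
  then have "\<alpha>\<^sup>2 * n * (\<theta> * (2 * K * Q - dd e F z)) \<le> \<alpha>\<^sup>2 * n * (\<phi> + 2 * (\<alpha> - 1) * Q)"
    using n by (intro mult_left_mono) auto
  also have "\<dots> < 2 * (\<theta> * \<phi>) * (\<phi> + 2 * (\<alpha> - 1) * Q)"
  proof (rule mult_strict_right_mono)
    show "\<alpha>\<^sup>2 * n < 2 * (\<theta> * \<phi>)" using big by (simp add: mult.commute)
    show "0 < \<phi> + 2 * (\<alpha> - 1) * Q" using \<phi>0 Q \<alpha> by (intro add_pos_nonneg) auto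
  qed
  also have "\<dots> \<le> 2 * (\<theta> * \<phi>) * (\<phi> + 2 * (\<alpha> - 1) * Q) + 2 * \<theta> * ((\<alpha> - 1) * Q)\<^sup>2"
    using \<theta>(1) by simp
  also have "\<dots> = \<theta> * (2 * (\<phi> + (\<alpha> - 1) * Q)\<^sup>2)"
    by (simp add: power2_eq_square algebra_simps)
  also have "\<alpha>\<^sup>2 * n * (\<theta> * (2 * K * Q - dd e F z)) = \<theta> * (\<alpha>\<^sup>2 * n * (2 * K * Q - dd e F z))"
    by (simp only: mult_ac)
  finally show False using 1 by simp
qed

end

section \<open>The operators of a metric in a chart\<close>

lemma positive_definite_matrix_inv:
  fixes M :: "real^'n^'n"
  assumes sym: "transpose M = M" and pos: "\<And>v. v \<noteq> 0 \<Longrightarrow> v \<bullet> (M *v v) > 0"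
  shows "M ** matrix_inv M = mat 1" "matrix_inv M ** M = mat 1" "det M \<noteq> 0"
    "transpose (matrix_inv M) = matrix_inv M" "v \<bullet> (matrix_inv M *v v) \<ge> 0"
proof -
  have "\<forall>x. M *v x = 0 \<longrightarrow> x = 0" using pos by (metis inner_zero_right less_irrefl)
  then have inv: "invertible M" using invertible_left_inverse matrix_left_invertible_ker by blast
  then show "det M \<noteq> 0" by (simp add: invertible_det_nz)
  have *: "M ** matrix_inv M = mat 1 \<and> matrix_inv M ** M = mat 1"
    unfolding matrix_inv_def using inv unfolding invertible_def by (rule someI_ex)
  then show 1: "M ** matrix_inv M = mat 1" and 2: "matrix_inv M ** M = mat 1" by auto
  have "transpose (matrix_inv M) ** M = mat 1"
    using arg_cong[OF 1, of transpose] by (simp add: matrix_transpose_mul sym)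
  then show "transpose (matrix_inv M) = matrix_inv M"
    by (metis 1 matrix_mul_assoc matrix_mul_lid matrix_mul_rid)
  have "v = M *v (matrix_inv M *v v)" by (simp add: matrix_vector_mul_assoc 1)
  then have "v \<bullet> (matrix_inv M *v v) = (matrix_inv M *v v) \<bullet> (M *v (matrix_inv M *v v))"
    by (metis inner_commute)
  then show "v \<bullet> (matrix_inv M *v v) \<ge> 0"
    using pos by (metis inner_zero_left less_eq_real_def)
qed

text \<open>By Cramer's rule the entries of the inverse matrix are rational functions of those of the
  matrix.\<close>

lemma smooth_on_matrix_inv:
  fixes M :: "'a::real_normed_vector \<Rightarrow> real^'n^'n"
  assumes S: "open S" and M: "smooth_on S M"
    and inv: "\<And>z. z \<in> S \<Longrightarrow> M z ** matrix_inv (M z) = mat 1 \<and> det (M z) \<noteq> 0"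
  shows "smooth_on S (\<lambda>z. matrix_inv (M z) $ k $ j)"
proof -
  have entry: "smooth_on S (\<lambda>z. M z $ a $ b)" for a b
    by (rule smooth_on_bounded_linear[OF S _ M, of "\<lambda>m. m $ a $ b"])
      (intro bounded_linear_compose[OF bounded_linear_vec_nth] bounded_linear_vec_nth)
  have det: "smooth_on S (\<lambda>z. det (N z))" if "\<And>a b. smooth_on S (\<lambda>z. N z $ a $ b)"
    for N :: "'a \<Rightarrow> real^'n^'n"
    unfolding det_def by (intro smooth_on_sum[OF S] smooth_on_mult[OF S] smooth_on_const smooth_on_prod[OF S] that)
  let ?N = "\<lambda>z. (\<chi> a b. if b = k then axis j 1 $ a else M z $ a $ b) :: real^'n^'n"
  have N: "smooth_on S (\<lambda>z. det (?N z) * inverse (det (M z)))"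
  proof (rule smooth_on_mult[OF S det smooth_on_inverse[OF S det[OF entry]]])
    show "smooth_on S (\<lambda>z. ?N z $ a $ b)" for a b
      by (cases "b = k") (simp_all add: entry)
    show "det (M z) \<noteq> 0" if "z \<in> S" for z using inv[OF that] by simp
  qed
  show ?thesis
  proof (rule smooth_on_cong[OF S N])
    fix z assume z: "z \<in> S"
    have "M z *v (matrix_inv (M z) *v axis j 1) = axis j 1"
      using inv[OF z] by (simp add: matrix_vector_mul_assoc)
    then have "matrix_inv (M z) *v axis j 1 = (\<chi> k. det (\<chi> a b. if b = k then axis j 1 $ a else M z $ a $ b) / det (M z))"
      using cramer[of "M z"] inv[OF z] by blast
    then have "(matrix_inv (M z) *v axis j 1) $ k = det (?N z) / det (M z)" by simp
    then show "det (?N z) * inverse (det (M z)) = matrix_inv (M z) $ k $ j"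
      by (simp add: matrix_vector_mult_basis column_def divide_inverse)
  qed
qed

text \<open>The space-time domain of a chart with image \<open>V\<close>, with the coordinate operators of the metric \<open>G\<close>
  acting on functions of space and time. The following equations identify these operators with the
  ones defined for functions of the coordinates alone, at each fixed time.\<close>

locale metric_chart =
  fixes V :: "(real^'n::finite) set" and G :: "real^'n \<Rightarrow> real^'n^'n"
  assumes V: "open V" and G: "smooth_on V G"
    and G_sym: "y \<in> V \<Longrightarrow> transpose (G y) = G y"
    and G_pos: "y \<in> V \<Longrightarrow> v \<noteq> 0 \<Longrightarrow> metric_inner G y v v > 0"
begin

lemmas G_inv = positive_definite_matrix_inv[OF G_sym G_pos[unfolded metric_inner_def]]

definition gm :: "'n \<Rightarrow> 'n \<Rightarrow> (real^'n) \<times> real \<Rightarrow> real" where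
  "gm i j z = G (fst z) $ i $ j"

definition hm :: "'n \<Rightarrow> 'n \<Rightarrow> (real^'n) \<times> real \<Rightarrow> real" where
  "hm i j z = matrix_inv (G (fst z)) $ i $ j"

definition dir :: "'n \<Rightarrow> (real^'n) \<times> real" where
  "dir i = (axis i 1, 0)"

lemma smooth_entries:
  "smooth_on V (\<lambda>y. G y $ i $ j)" "smooth_on V (\<lambda>y. matrix_inv (G y) $ i $ j)"
proof -
  show "smooth_on V (\<lambda>y. G y $ i $ j)"
    by (rule smooth_on_bounded_linear[OF V _ G, of "\<lambda>m. m $ i $ j"])
      (intro bounded_linear_compose[OF bounded_linear_vec_nth] bounded_linear_vec_nth)
  show "smooth_on V (\<lambda>y. matrix_inv (G y) $ i $ j)"
    by (rule smooth_on_matrix_inv[OF V G]) (simp add: G_inv)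
qed

lemma transpose_nth: "transpose M = M \<Longrightarrow> M $ i $ j = M $ j $ i"
  by (drule arg_cong[where f = "\<lambda>m. m $ j $ i"]) (simp add: transpose_def)

sublocale static_metric "V \<times> {0<..}" dir gm hm "(0, 1)"
proof
  show "open (V \<times> {0::real<..})" using V by (simp add: open_Times)
  show "smooth_on (V \<times> {0<..}) (gm i j)" "smooth_on (V \<times> {0<..}) (hm i j)" for i j
    unfolding gm_def[abs_def] hm_def[abs_def]
    by (rule smooth_on_fst[OF V open_greaterThan smooth_entries(1)],
        rule smooth_on_fst[OF V open_greaterThan smooth_entries(2)])
  fix z :: "(real^'n) \<times> real" assume "z \<in> V \<times> {0<..}"
  then have z: "fst z \<in> V" by auto
  show "gm i j z = gm j i z" "hm i j z = hm j i z" for i j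
    using transpose_nth[OF G_sym[OF z]] transpose_nth[OF G_inv(4)[OF z z]] by (simp_all add: gm_def hm_def)
  show "(\<Sum>j\<in>UNIV. hm i j z * gm j k z) = (if i = k then 1 else 0)" for i k
    using arg_cong[OF G_inv(2)[OF z z], of "\<lambda>m. m $ i $ k"]
    by (simp add: gm_def hm_def matrix_matrix_mult_def mat_def)
  show "dd (0, 1) (gm i j) z = 0" "dd (0, 1) (hm i j) z = 0" for i j
    using dd_direction_linear(2)[OF smooth_entries(1) z, of 0 0 i j]
      dd_direction_linear(2)[OF smooth_entries(2) z, of 0 0 i j]
    unfolding gm_def[abs_def] hm_def[abs_def]
    by (simp_all add: dd_fst[OF smooth_entries(1) z] dd_fst[OF smooth_entries(2) z])
qed

lemma hm_psd:
  assumes "fst z \<in> V"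
  shows "0 \<le> quad_form (\<lambda>i j. hm i j z) v"
proof -
  have "quad_form (\<lambda>i j. hm i j z) v = (\<chi> i. v i) \<bullet> (matrix_inv (G (fst z)) *v (\<chi> i. v i))"
    by (simp add: quad_form_def hm_def inner_vec_def matrix_vector_mult_def sum_distrib_left mult.assoc)
  then show ?thesis using G_inv(5)[OF assms assms] by simp
qed

lemma partial_deriv_slice:
  assumes "smooth_on (V \<times> {0<..}) F" "y \<in> V" "t > 0" "\<And>x. x \<in> V \<Longrightarrow> f x = F (x, t)"
  shows "partial_deriv i f y = dd (dir i) F (y, t)"
proof -
  have "partial_deriv i f y = dd (axis i 1) (\<lambda>x. F (x, t)) y"
    unfolding partial_deriv_def dd_def[symmetric] by (rule dd_cong[OF V assms(2,4)])
  then show ?thesis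
    using dd_slice[OF assms(1), of y t "axis i 1"] assms by (simp add: dir_def dd_def)
qed

lemma christoffel_eq:
  assumes "y \<in> V" "t > 0"
  shows "christoffel G k i j y = Gam k i j (y, t)"
proof -
  have "partial_deriv i (\<lambda>z. G z $ a $ b) y = dd (dir i) (gm a b) (y, t)" for i a b
    by (rule partial_deriv_slice[OF g assms]) (simp add: gm_def)
  then show ?thesis
    by (simp add: christoffel_def Gam_def Gam1_def sum_distrib_left hm_def mult_ac)
qed

lemma ricci_eq:
  assumes "y \<in> V" "t > 0"
  shows "ricci G y v v = ric (\<lambda>i. v $ i) (y, t)"
proof -
  have "partial_deriv a (christoffel G k i j) y = dd (dir a) (Gam k i j) (y, t)" for a k i j
    by (rule partial_deriv_slice[OF smooth_Gam assms]) (rule christoffel_eq[OF _ assms(2)])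
  then show ?thesis
    by (simp add: ricci_def ric_def riemann_def christoffel_eq[OF assms])
qed

lemma grad_eq:
  assumes "smooth_on (V \<times> {0<..}) F" "y \<in> V" "t > 0" "\<And>x. x \<in> V \<Longrightarrow> f x = F (x, t)"
  shows "grad G f y $ i = grd F i (y, t)"
  using partial_deriv_slice[OF assms] by (simp add: grad_def grd_def hm_def matrix_vector_mult_def)

lemma laplacian_eq:
  assumes "smooth_on (V \<times> {0<..}) F" "y \<in> V" "t > 0" "\<And>x. x \<in> V \<Longrightarrow> f x = F (x, t)"
  shows "laplacian G f y = lap F (y, t)"
proof -
  have "partial_deriv i (\<lambda>z. grad G f z $ i) y = dd (dir i) (grd F i) (y, t)" for i
    by (rule partial_deriv_slice[OF smooth_grd[OF assms(1)] assms(2,3)])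
      (rule grad_eq[OF assms(1) _ assms(3,4)])
  then show ?thesis
    by (simp add: laplacian_def divergence_def lap_def dv_def cov_def christoffel_eq[OF assms(2,3)] grad_eq[OF assms])
qed

lemma metric_inner_grad:
  assumes "y \<in> V"
  shows "metric_inner G y w (grad G f y) = (\<Sum>i\<in>UNIV. w $ i * partial_deriv i f y)"
  unfolding metric_inner_def grad_def
  by (simp add: matrix_vector_mul_assoc G_inv(1)[OF assms assms] inner_vec_def)

lemma metric_inner_grad_grad:
  assumes "smooth_on (V \<times> {0<..}) F" "y \<in> V" "t > 0" "\<And>x. x \<in> V \<Longrightarrow> f x = F (x, t)"
  shows "metric_inner G y (grad G f y) (grad G f y) = nsq F (y, t)"
proof -
  have "grad G f y $ i = grd F i (y, t)" "partial_deriv i f y = dd (dir i) F (y, t)" for i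
    by (rule grad_eq[OF assms], assumption) (rule partial_deriv_slice[OF assms])
  then show ?thesis
    unfolding metric_inner_grad[OF assms(2)] nsq_def by (simp add: mult.commute)
qed

text \<open>The squared length of the gradient is the maximum over all \<open>w\<close> of \<open>2 df(w) - |w|\<^sup>2\<close>, attained
  at the gradient itself, because \<open>|grad f - w|\<^sup>2 \<ge> 0\<close>. This expression involves no coordinates.\<close>

lemma grad_variational:
  assumes y: "y \<in> V" and f: "f differentiable at y"
  defines "D \<equiv> frechet_derivative f (at y)" and "v \<equiv> grad G f y"
  shows "metric_inner G y v v = 2 * D v - metric_inner G y v v"
    and "2 * D w - metric_inner G y w w \<le> metric_inner G y v v"
proof -
  have D: "metric_inner G y w v = D w" for w
  proof -
    have lin: "linear D" unfolding D_def by (rule linear_frechet_derivative[OF f])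
    have "D w = D (\<Sum>i\<in>UNIV. w $ i *\<^sub>R axis i 1)"
      using basis_expansion[of w] by (simp add: scalar_mult_eq_scaleR)
    also have "\<dots> = (\<Sum>i\<in>UNIV. w $ i * D (axis i 1))"
      by (simp add: linear_sum[OF lin] linear_scale[OF lin])
    finally show ?thesis
      unfolding v_def metric_inner_grad[OF y] by (simp add: D_def partial_deriv_def)
  qed
  show "metric_inner G y v v = 2 * D v - metric_inner G y v v" using D[of v] by simp
  have "metric_inner G y v w = metric_inner G y w v"
    unfolding metric_inner_def
    by (metis G_sym[OF y] dot_lmul_matrix inner_commute transpose_matrix_vector)
  then have "metric_inner G y (v - w) (v - w) = metric_inner G y v v - 2 * D w + metric_inner G y w w"
    using D[of w] by (simp add: metric_inner_def inner_diff_left inner_diff_right matrix_vector_mult_diff_distrib)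
  moreover have "metric_inner G y (v - w) (v - w) \<ge> 0"
    using G_pos[OF y, of "v - w"] by (cases "v - w = 0") (auto simp: metric_inner_def)
  ultimately show "2 * D w - metric_inner G y w w \<le> metric_inner G y v v" by linarith
qed

lemma slice_differentiable:
  assumes "smooth_on (V \<times> {0<..}) F" "y \<in> V" "t > 0" "\<And>x. x \<in> V \<Longrightarrow> f x = F (x, t)"
  shows "f differentiable at y"
proof -
  have "((\<lambda>y. (y, t)) has_derivative (\<lambda>v. (v, 0))) (at y)"
    by (auto intro!: derivative_eq_intros)
  from has_derivative_compose[OF this smooth_on_has_derivative[OF assms(1)]] assms(2,3)
  have "(\<lambda>x. F (x, t)) differentiable at y" by (auto simp: differentiable_def)
  then show ?thesis by (rule differentiable_cong_open[OF V assms(2), rotated]) (simp add: assms(4))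
qed

text \<open>The pointwise argument applies at a maximum over the chart: maximality in space gives the conditions
  on \<open>\<nabla>F\<close> and \<open>\<Delta>F\<close>, and the comparison with earlier times bounds the derivative of \<open>(t - a) F\<close>
  from below. Later times are not compared, so \<open>t\<close> may be the final time.\<close>

lemma harnack_at_chart_max:
  fixes \<alpha> K \<theta> a t :: real
  assumes W: "smooth_on (V \<times> {0<..}) W" and pos: "\<And>z. z \<in> V \<times> {0<..} \<Longrightarrow> W z > 0"
    and heat: "\<And>z. z \<in> V \<times> {0<..} \<Longrightarrow> dd (0, 1) W z = lap W z"
    and ricci: "\<And>y v. y \<in> V \<Longrightarrow> ricci G y v v \<ge> - K * metric_inner G y v v"
    and y: "y \<in> V" and t: "t > 0"
    and \<alpha>: "\<alpha> > 1" and K: "K \<ge> 0" and \<theta>: "0 < \<theta>" "\<theta> \<le> t - a" "K * \<theta> \<le> \<alpha> - 1"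
  defines "f \<equiv> \<lambda>z. ln (W z)"
  defines "F \<equiv> \<lambda>z. nsq f z - \<alpha> * dd (0, 1) f z"
  assumes space_max: "\<And>x. x \<in> V \<Longrightarrow> F (x, t) \<le> F (y, t)"
    and time_max: "\<And>s. a < s \<Longrightarrow> s < t \<Longrightarrow> (s - a) * F (y, s) \<le> (t - a) * F (y, t)"
  shows "\<theta> * F (y, t) \<le> real CARD('n) * \<alpha>\<^sup>2 / 2"
proof -
  let ?S = "V \<times> {0::real<..}"
  have z: "(y, t) \<in> ?S" using y t by simp
  have f: "smooth_on ?S f" unfolding f_def by (rule smooth_on_ln[OF S W pos])
  have F: "smooth_on ?S F"
    unfolding F_def by (intro smooth_arith smooth_nsq f)
  have eq: "dd (0, 1) f z = lap f z + nsq f z" if "z \<in> ?S" for z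
    using lap_ln[OF that W pos] heat[OF that] pos[OF that] unfolding f_def dd_ln[OF W that pos[OF that]]
    by simp
  let ?v = "\<lambda>r. \<Sum>i\<in>UNIV. r i *\<^sub>R dir i"
  have max: "\<exists>d>0. \<forall>x. \<bar>x\<bar> < d \<longrightarrow> (y, t) + x *\<^sub>R ?v r \<in> ?S \<and> F ((y, t) + x *\<^sub>R ?v r) \<le> F (y, t)" for r
  proof -
    have v: "?v r = ((\<Sum>i\<in>UNIV. r i *\<^sub>R axis i 1), 0)"
      by (simp add: dir_def prod_eq_iff fst_sum snd_sum)
    let ?w = "\<Sum>i\<in>UNIV. r i *\<^sub>R axis i (1::real) :: real^'n"
    have "((\<lambda>x. y + x *\<^sub>R ?w) \<longlongrightarrow> y + 0 *\<^sub>R ?w) (at 0)"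
      by (intro tendsto_intros)
    then have "\<forall>\<^sub>F x in at 0. y + x *\<^sub>R ?w \<in> V"
      using V y by (simp add: topological_tendstoD)
    then obtain d where d: "d > 0" and d': "\<And>x. x \<noteq> 0 \<Longrightarrow> dist x 0 < d \<Longrightarrow> y + x *\<^sub>R ?w \<in> V"
      unfolding eventually_at by auto
    have inV: "y + x *\<^sub>R ?w \<in> V" if "\<bar>x\<bar> < d" for x
      using d'[of x] that y by (cases "x = 0") auto
    show ?thesis
      unfolding v using d inV t by (intro exI[of _ d]) (auto intro: space_max)
  qed
  note psd = hm_psd[of "(y, t)", simplified, OF y]
  have ric: "ric (\<lambda>i. grd f i (y, t)) (y, t) \<ge> - K * nsq f (y, t)"
  proof -
    let ?f = "\<lambda>x. f (x, t)" 
    have "ric (\<lambda>i. grd f i (y, t)) (y, t) = ricci G y (grad G ?f y) (grad G ?f y)"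
      unfolding ricci_eq[OF y t] grad_eq[OF f y t refl] ..
    with ricci[OF y, of "grad G ?f y"] show ?thesis
      by (simp add: metric_inner_grad_grad[OF f y t refl])
  qed
  have TF: "F (y, t) + (t - a) * dd (0, 1) F (y, t) \<ge> 0"
  proof (rule ccontr)
    assume neg: "\<not> ?thesis"
    have "((\<lambda>s. (s - a) * F (y, s)) has_real_derivative F (y, t) + (t - a) * dd (0, 1) F (y, t)) (at t)"
      by (rule derivative_eq_intros dd_time[OF F z] refl | simp)+
    from DERIV_neg_dec_left[OF this] neg obtain d where d: "d > 0"
      "\<And>h. 0 < h \<Longrightarrow> h < d \<Longrightarrow> (t - a) * F (y, t) < (t - h - a) * F (y, t - h)" by auto
    define h where "h = min d (t - a) / 2"
    have "0 < h" "h < d" "h < t - a" using d(1) \<theta> by (auto simp: h_def)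
    then show False using d(2)[of h] time_max[of "t - h"] by simp
  qed
  show ?thesis
    unfolding F_def
    by (rule harnack_at_max[OF z f eq psd ric \<alpha> K \<theta>], assumption)
      (fact local_max_lap_le_zero[OF z F psd max, unfolded F_def] TF[unfolded F_def])+
qed

end

section \<open>The estimate on a compact manifold\<close>

lemma chart_facts:
  assumes "is_chart X c"
  shows "openin X (fst c)" "fst c \<subseteq> topspace X" "open (chart_image c)"
    "continuous_map (subtopology X (fst c)) (top_of_set (chart_image c)) (snd c)"
    "x \<in> fst c \<Longrightarrow> chart_inv c (snd c x) = x"
    "y \<in> chart_image c \<Longrightarrow> chart_inv c y \<in> fst c"
    "y \<in> chart_image c \<Longrightarrow> snd c (chart_inv c y) = y"
    "x \<in> fst c \<Longrightarrow> snd c x \<in> chart_image c"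
    "openin X U \<Longrightarrow> open (snd c ` (fst c \<inter> U))"
proof -
  show op: "openin X (fst c)" and oi: "open (chart_image c)"
    using assms by (auto simp: is_chart_def)
  show sub: "fst c \<subseteq> topspace X" using op by (rule openin_subset)
  have hom: "homeomorphic_map (subtopology X (fst c)) (top_of_set (chart_image c)) (snd c)"
    using assms by (auto simp: is_chart_def)
  show "continuous_map (subtopology X (fst c)) (top_of_set (chart_image c)) (snd c)"
    by (rule homeomorphic_imp_continuous_map[OF hom])
  have inj: "inj_on (snd c) (fst c)"
    using homeomorphic_imp_injective_map[OF hom] sub by (simp add: Int_absorb1)
  show "x \<in> fst c \<Longrightarrow> chart_inv c (snd c x) = x"
    by (simp add: chart_inv_def inv_into_f_f[OF inj])
  show "y \<in> chart_image c \<Longrightarrow> chart_inv c y \<in> fst c"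
    "y \<in> chart_image c \<Longrightarrow> snd c (chart_inv c y) = y"
    by (auto simp: chart_inv_def chart_image_def inv_into_into f_inv_into_f)
  show "x \<in> fst c \<Longrightarrow> snd c x \<in> chart_image c" by (simp add: chart_image_def)
  show "open (snd c ` (fst c \<inter> U))" if "openin X U"
  proof -
    have "openin (subtopology X (fst c)) (fst c \<inter> U)"
      using that by (simp add: openin_subtopology_Int2)
    then have "openin (top_of_set (chart_image c)) (snd c ` (fst c \<inter> U))"
      using homeomorphic_map_openness[OF hom, of "fst c \<inter> U"] sub by auto
    then show ?thesis using oi openin_open_trans by blast
  qed
qed

locale positive_heat_solution =
  fixes X :: "'a topology" and A :: "('a, 'n::finite) chart set"
    and g :: "('a, 'n) chart \<Rightarrow> real^'n \<Rightarrow> real^'n^'n" and u :: "'a \<Rightarrow> real \<Rightarrow> real"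
  assumes manifold: "riemannian_manifold X A g" and heat: "heat_solution A g u"
    and pos: "\<And>x t. x \<in> topspace X \<Longrightarrow> t > 0 \<Longrightarrow> u x t > 0"
begin

text \<open>The quantity \<open>|\<nabla> log u|\<^sup>2 - \<alpha> (log u)\<^sub>t\<close> at \<open>(x, t)\<close>, computed in the chart \<open>c\<close>.\<close>

definition harnack :: "real \<Rightarrow> ('a, 'n) chart \<Rightarrow> 'a \<Rightarrow> real \<Rightarrow> real" where
  "harnack \<alpha> c x t = grad_norm_sq g c (\<lambda>z. ln (u z t)) x - \<alpha> * deriv (\<lambda>s. ln (u x s)) t"

definition in_chart :: "('a, 'n) chart \<Rightarrow> (real^'n) \<times> real \<Rightarrow> real" where
  "in_chart c z = u (chart_inv c (fst z)) (snd z)"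

lemma is_chart: "c \<in> A \<Longrightarrow> is_chart X c"
  using manifold by (simp add: riemannian_manifold_def smooth_manifold_def)

lemma metric_chart: "c \<in> A \<Longrightarrow> metric_chart (chart_image c) (g c)"
  using manifold is_chart[of c]
  by (simp add: metric_chart_def riemannian_manifold_def riemannian_metric_def chart_facts)

lemma in_chart_smooth: "c \<in> A \<Longrightarrow> smooth_on (chart_image c \<times> {0<..}) (in_chart c)"
  using heat by (simp add: heat_solution_def in_chart_def[abs_def] case_prod_unfold)

lemma in_chart_pos: "c \<in> A \<Longrightarrow> z \<in> chart_image c \<times> {0<..} \<Longrightarrow> in_chart c z > 0"
  unfolding in_chart_def using chart_facts(2,6)[OF is_chart, of c] by (intro pos) auto

lemma ln_in_chart_smooth: "c \<in> A \<Longrightarrow> smooth_on (chart_image c \<times> {0<..}) (\<lambda>z. ln (in_chart c z))"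
  using chart_facts(3)[OF is_chart, of c]
  by (intro smooth_on_ln in_chart_smooth in_chart_pos) (auto intro: open_Times)

abbreviation log_in_chart :: "('a, 'n) chart \<Rightarrow> (real^'n) \<times> real \<Rightarrow> real" where
  "log_in_chart c \<equiv> \<lambda>z. ln (in_chart c z)"

abbreviation harnack_in_chart :: "real \<Rightarrow> ('a, 'n) chart \<Rightarrow> (real^'n) \<times> real \<Rightarrow> real" where
  "harnack_in_chart \<alpha> c \<equiv> \<lambda>z.
    coordinate_metric.nsq metric_chart.dir (metric_chart.hm (g c)) (log_in_chart c) z
    - \<alpha> * dd (0, 1) (log_in_chart c) z"

lemma harnack_eq:
  assumes c: "c \<in> A" and x: "x \<in> fst c" and t: "t > 0"
  shows "harnack \<alpha> c x t = harnack_in_chart \<alpha> c (snd c x, t)"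
proof -
  interpret M: metric_chart "chart_image c" "g c" by (rule metric_chart[OF c])
  note cf = chart_facts[OF is_chart[OF c]]
  note f = ln_in_chart_smooth[OF c]
  have y: "snd c x \<in> chart_image c" using cf(8) x by simp
  have "grad_norm_sq g c (\<lambda>z. ln (u z t)) x = M.nsq (log_in_chart c) (snd c x, t)"
    unfolding grad_norm_sq_def Let_def
    by (rule M.metric_inner_grad_grad[OF f y t]) (simp add: in_chart_def)
  moreover have "((\<lambda>s. ln (u x s)) has_real_derivative dd (0, 1) (log_in_chart c) (snd c x, t)) (at t)"
    using dd_time[OF f, of "snd c x" t] y t by (simp add: in_chart_def cf(5)[OF x])
  ultimately show ?thesis unfolding harnack_def by (simp add: DERIV_imp_deriv)
qed

lemma continuous_on_harnack_in_chart:
  assumes c: "c \<in> A"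
  shows "continuous_on (chart_image c \<times> {0<..}) (harnack_in_chart \<alpha> c)"
proof -
  interpret M: metric_chart "chart_image c" "g c" by (rule metric_chart[OF c])
  show ?thesis
    by (intro smooth_on_continuous_on M.smooth_arith M.smooth_nsq ln_in_chart_smooth[OF c])
qed

lemma log_slice_differentiable:
  assumes c: "c \<in> A" and y: "y \<in> chart_image c" and t: "t > 0"
  shows "((\<lambda>z. ln (u z t)) \<circ> chart_inv c) differentiable at y"
proof -
  interpret M: metric_chart "chart_image c" "g c" by (rule metric_chart[OF c])
  show ?thesis
    by (rule M.slice_differentiable[OF ln_in_chart_smooth[OF c] y t]) (simp add: in_chart_def)
qed

text \<open>By the variational description of the squared length, the gradient in one chart, pushed forward by
  the transition map, is a competitor in the other chart. Exchanging the charts gives equality, so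
  the transformation of the inverse matrices need not be computed.\<close>

lemma grad_norm_sq_chart_le:
  assumes c: "c \<in> A" and d: "d \<in> A" and x: "x \<in> fst c" "x \<in> fst d" and t: "t > 0"
  shows "grad_norm_sq g c (\<lambda>z. ln (u z t)) x \<le> grad_norm_sq g d (\<lambda>z. ln (u z t)) x"
proof -
  interpret C: metric_chart "chart_image c" "g c" by (rule metric_chart[OF c])
  interpret D: metric_chart "chart_image d" "g d" by (rule metric_chart[OF d])
  note cf = chart_facts[OF is_chart[OF c]] and df = chart_facts[OF is_chart[OF d]]
  let ?f = "\<lambda>z. ln (u z t)" and ?\<tau> = "transition c d"
  let ?O = "snd c ` (fst c \<inter> fst d)" and ?y = "snd c x"
  have O: "open ?O" "?y \<in> ?O" using cf(9)[OF df(1)] x by auto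
  have \<tau>: "?\<tau> (snd c x') = snd d x'" if "x' \<in> fst c" for x'
    by (simp add: transition_def cf(5)[OF that])
  have "smooth_on ?O ?\<tau>"
    using manifold c d by (simp add: riemannian_manifold_def smooth_manifold_def)
  then have d\<tau>: "(?\<tau> has_derivative (\<lambda>v. dd v ?\<tau> ?y)) (at ?y)"
    using O(2) by (rule smooth_on_has_derivative)
  have "((?f \<circ> chart_inv d) has_derivative (\<lambda>v. dd v (?f \<circ> chart_inv d) (?\<tau> ?y))) (at (?\<tau> ?y))"
    using log_slice_differentiable[OF d df(8)[OF x(2)] t]
    by (simp add: \<tau>[OF x(1)] differentiable_has_dd)
  from has_derivative_compose[OF d\<tau> this]
  have comp: "dd v (\<lambda>y. (?f \<circ> chart_inv d) (?\<tau> y)) ?y = dd (dd v ?\<tau> ?y) (?f \<circ> chart_inv d) (?\<tau> ?y)" for v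
    by (rule dd_eqI)
  have Df: "dd v (?f \<circ> chart_inv c) ?y = dd (dd v ?\<tau> ?y) (?f \<circ> chart_inv d) (snd d x)" for v
  proof -
    have "dd v (?f \<circ> chart_inv c) ?y = dd v (\<lambda>y. (?f \<circ> chart_inv d) (?\<tau> y)) ?y"
      by (rule dd_cong[OF O]) (auto simp: \<tau> cf(5) df(5))
    then show ?thesis using comp \<tau>[OF x(1)] by simp
  qed
  have metric: "metric_inner (g c) ?y v v = metric_inner (g d) (snd d x) (dd v ?\<tau> ?y) (dd v ?\<tau> ?y)" for v
  proof -
    have "metric_inner (g c) ?y v w = metric_inner (g d) (?\<tau> ?y) (dd v ?\<tau> ?y) (dd w ?\<tau> ?y)" for w
      using manifold c d O(2) unfolding riemannian_manifold_def riemannian_metric_def dd_def by blast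
    then show ?thesis by (simp only: \<tau>[OF x(1)])
  qed
  let ?v = "grad (g c) (?f \<circ> chart_inv c) ?y"
  have "grad_norm_sq g c ?f x = 2 * dd ?v (?f \<circ> chart_inv c) ?y - metric_inner (g c) ?y ?v ?v"
    using C.grad_variational(1)[OF cf(8)[OF x(1)] log_slice_differentiable[OF c cf(8)[OF x(1)] t]]
    by (simp add: grad_norm_sq_def Let_def dd_def)
  also have "\<dots> \<le> grad_norm_sq g d ?f x"
    unfolding Df metric
    using D.grad_variational(2)[OF df(8)[OF x(2)] log_slice_differentiable[OF d df(8)[OF x(2)] t],
        of "dd ?v ?\<tau> ?y"]
    by (simp add: grad_norm_sq_def Let_def dd_def)
  finally show ?thesis .
qed

lemma harnack_chart_independent:
  assumes "c \<in> A" "d \<in> A" "x \<in> fst c" "x \<in> fst d" "t > 0"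
  shows "harnack \<alpha> c x t = harnack \<alpha> d x t"
  using grad_norm_sq_chart_le[of c d x t] grad_norm_sq_chart_le[of d c x t] assms
  by (simp add: harnack_def)

text \<open>Translation of the estimate from the chart image to the manifold. The heat equation is available in
  every chart, so the chart may be chosen around the given point.\<close>

lemma harnack_at_max_on_chart_domain:
  fixes \<alpha> K \<theta> a t :: real
  assumes c: "c \<in> A" and x: "x \<in> fst c" and t: "t > 0"
    and ricci: "ricci_bounded_below A g (- K)"
    and \<alpha>: "\<alpha> > 1" and K: "K \<ge> 0" and a: "a \<ge> 0" and \<theta>: "0 < \<theta>" "\<theta> \<le> t - a" "K * \<theta> \<le> \<alpha> - 1"
    and space_max: "\<And>x'. x' \<in> fst c \<Longrightarrow> harnack \<alpha> c x' t \<le> harnack \<alpha> c x t"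
    and time_max: "\<And>s. a < s \<Longrightarrow> s < t \<Longrightarrow> (s - a) * harnack \<alpha> c x s \<le> (t - a) * harnack \<alpha> c x t"
  shows "\<theta> * harnack \<alpha> c x t \<le> real CARD('n) * \<alpha>\<^sup>2 / 2"
proof -
  interpret M: metric_chart "chart_image c" "g c" by (rule metric_chart[OF c])
  note cf = chart_facts[OF is_chart[OF c]]
  have W: "smooth_on (chart_image c \<times> {0<..}) (in_chart c)" by (rule in_chart_smooth[OF c])
  have heat: "dd (0, 1) (in_chart c) z = M.lap (in_chart c) z" if "z \<in> chart_image c \<times> {0<..}" for z
  proof -
    obtain y s where z: "z = (y, s)" "y \<in> chart_image c" "s > 0" using \<open>z \<in> _\<close> by auto
    let ?x = "chart_inv c y"
    have "((\<lambda>s. u ?x s) has_real_derivative laplace_beltrami g c (\<lambda>x. u x s) ?x) (at s)"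
      using heat c cf(6)[OF z(2)] z(3) by (simp add: heat_solution_def)
    moreover have "((\<lambda>s. u ?x s) has_real_derivative dd (0, 1) (in_chart c) (y, s)) (at s)"
      using dd_time[OF W, of y s] z by (simp add: in_chart_def)
    ultimately have "dd (0, 1) (in_chart c) (y, s) = laplace_beltrami g c (\<lambda>x. u x s) ?x"
      by (rule DERIV_unique[symmetric])
    also have "\<dots> = M.lap (in_chart c) (y, s)"
      unfolding laplace_beltrami_def cf(7)[OF z(2)]
      by (rule M.laplacian_eq[OF W z(2,3)]) (simp add: in_chart_def)
    finally show ?thesis by (simp add: z(1))
  qed
  have ricci': "ricci (g c) y v v \<ge> - K * metric_inner (g c) y v v" if "y \<in> chart_image c" for y v
    using ricci c that by (simp add: ricci_bounded_below_def)
  show ?thesis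
    unfolding harnack_eq[OF c x t]
  proof (rule M.harnack_at_chart_max[OF W in_chart_pos[OF c] heat ricci' cf(8)[OF x] t \<alpha> K \<theta>])
    show "harnack_in_chart \<alpha> c (y, t) \<le> harnack_in_chart \<alpha> c (snd c x, t)" if "y \<in> chart_image c" for y
      using space_max[OF cf(6)[OF that]] unfolding harnack_eq[OF c x t] harnack_eq[OF c cf(6)[OF that] t]
      by (simp only: cf(7)[OF that])
    show "(s - a) * harnack_in_chart \<alpha> c (snd c x, s) \<le> (t - a) * harnack_in_chart \<alpha> c (snd c x, t)"
      if "a < s" "s < t" for s
      using time_max[OF that] that a harnack_eq[OF c x t] harnack_eq[OF c x, of s] by simp
  qed
qed

text \<open>Maximise \<open>\<theta>(t) F\<close> with \<open>\<theta>(t) = min (t - \<epsilon>) \<tau>\<close>, which vanishes at the initial time. As \<open>\<theta>\<close> is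
  concave with \<open>\<theta>(\<epsilon>) = 0\<close>, the function \<open>(t - \<epsilon>) / \<theta>(t)\<close> is increasing, so that at the maximum also
  \<open>(t - \<epsilon>) F\<close> has not been larger at earlier times.\<close>

lemma weighted_harnack_bound:
  fixes \<alpha> K \<tau> \<epsilon> T :: real
  assumes compact: "compact_space X" and ricci: "ricci_bounded_below A g (- K)"
    and \<alpha>: "\<alpha> > 1" and K: "K \<ge> 0" and \<tau>: "\<tau> > 0" "K * \<tau> \<le> \<alpha> - 1" and \<epsilon>: "0 < \<epsilon>" "\<epsilon> < T"
    and c: "c \<in> A" and x: "x \<in> fst c"
  shows "min (T - \<epsilon>) \<tau> * harnack \<alpha> c x T \<le> real CARD('n) * \<alpha>\<^sup>2 / 2"
proof -
  \<comment> \<open>the value at \<open>(x, t)\<close> in any chart, as a function on the manifold\<close>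
  define H where "H x t = harnack \<alpha> (SOME c. c \<in> A \<and> x \<in> fst c) x t" for x t
  have H: "H x t = harnack \<alpha> c x t" if "c \<in> A" "x \<in> fst c" "t > 0" for c x t
  proof -
    have "(SOME c. c \<in> A \<and> x \<in> fst c) \<in> A \<and> x \<in> fst (SOME c. c \<in> A \<and> x \<in> fst c)"
      by (rule someI_ex) (use that in blast)
    then show ?thesis unfolding H_def using harnack_chart_independent that by blast
  qed
  have cover: "\<exists>c\<in>A. x \<in> fst c" if "x \<in> topspace X" for x
    using manifold that by (auto simp: riemannian_manifold_def smooth_manifold_def)
  define \<theta> where "\<theta> t = min (t - \<epsilon>) \<tau>" for t
  let ?I = "{\<epsilon>..T}"
  let ?Y = "prod_topology X (top_of_set ?I)"
  let ?\<Phi> = "\<lambda>(x, t). \<theta> t * H x t"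
  have cont: "continuous_map ?Y euclideanreal ?\<Phi>"
  proof (rule pasting_lemma[where I = A and T = "\<lambda>c. fst c \<times> ?I"
        and f = "\<lambda>c (x, t). \<theta> t * harnack_in_chart \<alpha> c (snd c x, t)"])
    fix c assume c: "c \<in> A"
    note cf = chart_facts[OF is_chart[OF c]]
    show "openin ?Y (fst c \<times> ?I)"
      using cf(1) by (simp add: openin_prod_Times_iff)
    have "continuous_map (prod_topology (subtopology X (fst c)) (top_of_set ?I))
       (prod_topology (top_of_set (chart_image c)) (top_of_set ?I)) (\<lambda>(x, t). (snd c x, t))"
      using cf(4) by (simp only: continuous_map_prod_top) simp
    moreover have "continuous_map (prod_topology (top_of_set (chart_image c)) (top_of_set ?I)) euclideanreal
      (\<lambda>z. \<theta> (snd z) * harnack_in_chart \<alpha> c z)"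
    proof -
      have "chart_image c \<times> ?I \<subseteq> chart_image c \<times> {0<..}" using \<epsilon> by auto
      then have "continuous_on (chart_image c \<times> ?I) (harnack_in_chart \<alpha> c)"
        using continuous_on_harnack_in_chart[OF c] continuous_on_subset by blast
      then have "continuous_on (chart_image c \<times> ?I) (\<lambda>z. \<theta> (snd z) * harnack_in_chart \<alpha> c z)"
        unfolding \<theta>_def by (rule continuous_on_mult[rotated]) (intro continuous_intros)
      then show ?thesis by simp
    qed
    ultimately have "continuous_map (prod_topology (subtopology X (fst c)) (top_of_set ?I)) euclideanreal
      ((\<lambda>z. \<theta> (snd z) * harnack_in_chart \<alpha> c z) \<circ> (\<lambda>(x, t). (snd c x, t)))"
      by (rule continuous_map_compose)
    moreover have "subtopology ?Y (fst c \<times> ?I) = prod_topology (subtopology X (fst c)) (top_of_set ?I)"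
      by (simp add: subtopology_Times subtopology_subtopology)
    ultimately show "continuous_map (subtopology ?Y (fst c \<times> ?I)) euclideanreal
      (\<lambda>(x, t). \<theta> t * harnack_in_chart \<alpha> c (snd c x, t))"
      by (simp add: o_def case_prod_unfold)
  next
    fix c d p assume cd: "c \<in> A" "d \<in> A" and p: "p \<in> topspace ?Y \<inter> (fst c \<times> ?I) \<inter> (fst d \<times> ?I)"
    obtain x t where xt: "p = (x, t)" by (cases p)
    then have "x \<in> fst c" "x \<in> fst d" "t > 0" using p \<epsilon> by auto
    then show "(case p of (x, t) \<Rightarrow> \<theta> t * harnack_in_chart \<alpha> c (snd c x, t))
        = (case p of (x, t) \<Rightarrow> \<theta> t * harnack_in_chart \<alpha> d (snd d x, t))"
      using harnack_chart_independent[OF cd, of x t] harnack_eq[of c x t \<alpha>] harnack_eq[of d x t \<alpha>] cd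
      by (simp add: xt)
  next
    fix p assume p: "p \<in> topspace ?Y"
    obtain x t where xt: "p = (x, t)" by (cases p)
    then have "x \<in> topspace X" "t \<in> ?I" using p by auto
    then obtain c where c: "c \<in> A" "x \<in> fst c" using cover by blast
    have "t > 0" using \<open>t \<in> ?I\<close> \<epsilon> by auto
    then show "\<exists>c. c \<in> A \<and> p \<in> fst c \<times> ?I
      \<and> ?\<Phi> p = (case p of (x, t) \<Rightarrow> \<theta> t * harnack_in_chart \<alpha> c (snd c x, t))"
      using c \<open>t \<in> ?I\<close> H[OF c, of t] harnack_eq[OF c, of t \<alpha>]
      by (intro exI[of _ c]) (simp add: xt)
  qed
  have xX: "x \<in> topspace X" using chart_facts(2)[OF is_chart[OF c]] x by blast
  have "compact_space ?Y"
    using compact by (simp add: compact_space_prod_topology compact_space_subtopology)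
  then have cpt: "compact (?\<Phi> ` topspace ?Y)"
    using image_compactin[OF _ cont, of "topspace ?Y"] by (simp add: compact_space_def)
  have ne: "?\<Phi> ` topspace ?Y \<noteq> {}" using xX \<epsilon> by auto
  obtain m where m: "m \<in> ?\<Phi> ` topspace ?Y" "\<And>w. w \<in> ?\<Phi> ` topspace ?Y \<Longrightarrow> w \<le> m"
    using compact_attains_sup[OF cpt ne] by blast
  then obtain x0 t0 where 0: "x0 \<in> topspace X" "t0 \<in> ?I" "m = \<theta> t0 * H x0 t0" by auto
  have max: "\<theta> t * H x t \<le> m" if "x \<in> topspace X" "t \<in> ?I" for x t
    using m(2)[of "\<theta> t * H x t"] that by force
  have "m \<le> real CARD('n) * \<alpha>\<^sup>2 / 2"
  proof (cases "t0 = \<epsilon> \<or> m \<le> 0")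
    case True
    then have "m \<le> 0" using 0 \<tau> by (auto simp: \<theta>_def)
    also have "0 \<le> real CARD('n) * \<alpha>\<^sup>2 / 2" by simp
    finally show ?thesis .
  next
    case False
    then have t0: "\<epsilon> < t0" "t0 \<le> T" "m > 0" using 0(2) by auto
    obtain d where d: "d \<in> A" "x0 \<in> fst d" using cover[OF 0(1)] by blast
    have t0': "t0 > 0" using t0 \<epsilon> by linarith
    have \<theta>0: "0 < \<theta> t0" "\<theta> t0 \<le> t0 - \<epsilon>" using t0 \<tau> by (auto simp: \<theta>_def)
    have K\<theta>: "K * \<theta> t0 \<le> \<alpha> - 1"
      using mult_left_mono[of "\<theta> t0" \<tau> K] K \<tau>(2) by (simp add: \<theta>_def)
    have H0: "m = \<theta> t0 * harnack \<alpha> d x0 t0" using 0(3) H[OF d t0'] by simp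
    have "\<theta> t0 * harnack \<alpha> d x0 t0 \<le> real CARD('n) * \<alpha>\<^sup>2 / 2"
    proof (rule harnack_at_max_on_chart_domain[OF d t0' ricci \<alpha> K _ \<theta>0 K\<theta>])
      show "\<epsilon> \<ge> 0" using \<epsilon> by simp
      show "harnack \<alpha> d x' t0 \<le> harnack \<alpha> d x0 t0" if x': "x' \<in> fst d" for x'
      proof -
        have "x' \<in> topspace X" using chart_facts(2)[OF is_chart[OF d(1)]] x' by blast
        then have "\<theta> t0 * harnack \<alpha> d x' t0 \<le> \<theta> t0 * harnack \<alpha> d x0 t0"
          using max[of x' t0] 0(2) H0 H[OF d(1) x' t0'] by simp
        then show ?thesis using \<theta>0 by simp
      qed
      show "(s - \<epsilon>) * harnack \<alpha> d x0 s \<le> (t0 - \<epsilon>) * harnack \<alpha> d x0 t0" if s: "\<epsilon> < s" "s < t0" for s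
      proof -
        have s0: "s > 0" using s \<epsilon> by linarith
        have \<theta>s: "\<theta> s > 0" using s \<tau> by (simp add: \<theta>_def)
        have "\<theta> s * harnack \<alpha> d x0 s \<le> m"
          using max[OF 0(1), of s] s t0 H[OF d s0] by simp
        then have "(s - \<epsilon>) * \<theta> t0 * (\<theta> s * harnack \<alpha> d x0 s) \<le> (s - \<epsilon>) * \<theta> t0 * m"
          using s \<theta>0 by (intro mult_left_mono) auto
        also have "(s - \<epsilon>) * \<theta> t0 \<le> (t0 - \<epsilon>) * \<theta> s"
          using s t0 \<tau> by (auto simp: \<theta>_def min_def mult_right_mono mult.commute)
        then have "(s - \<epsilon>) * \<theta> t0 * m \<le> (t0 - \<epsilon>) * \<theta> s * m"
          using t0(3) by (intro mult_right_mono) auto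
        finally have "(\<theta> s * \<theta> t0) * ((s - \<epsilon>) * harnack \<alpha> d x0 s) \<le> (\<theta> s * \<theta> t0) * ((t0 - \<epsilon>) * harnack \<alpha> d x0 t0)"
          unfolding H0 by (simp only: mult_ac)
        then show ?thesis using \<theta>s \<theta>0(1) by simp
      qed
    qed
    then show ?thesis using H0 by simp
  qed
  moreover have "T > 0" using \<epsilon> by linarith
  ultimately show ?thesis
    using max[OF xX, of T] H[OF c x, of T] \<epsilon> by (simp add: \<theta>_def)
qed

end

theorem corollary2p5:
  fixes X :: "'a topology"
    and A :: "('a, 'n::finite) chart set"
    and g :: "('a, 'n) chart \<Rightarrow> real^'n \<Rightarrow> real^'n^'n"
    and u :: "'a \<Rightarrow> real \<Rightarrow> real"
    and K \<alpha> :: real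
  assumes "riemannian_manifold X A g"
    and "compact_space X"
    and "K \<ge> 0"
    and "ricci_bounded_below A g (- K)"
    and "heat_solution A g u"
    and "\<forall>x\<in>topspace X. \<forall>t>0. u x t > 0"
    and "\<alpha> > 1"
  shows "\<forall>t>0. \<forall>c\<in>A. \<forall>x\<in>fst c.
           grad_norm_sq g c (\<lambda>z. ln (u z t)) x - \<alpha> * deriv (\<lambda>s. ln (u x s)) t
           \<le> real CARD('n) * \<alpha>\<^sup>2 / 2 * max (1 / t) (K / (\<alpha> - 1))"
proof (intro allI impI ballI)
  fix t :: real and c x
  assume t: "t > 0" and c: "c \<in> A" and x: "x \<in> fst c"
  interpret positive_heat_solution X A g u
    using assms by unfold_locales auto
  let ?C = "real CARD('n) * \<alpha>\<^sup>2 / 2"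
  \<comment> \<open>the largest admissible \<open>\<tau>\<close>; for \<open>K = 0\<close> every \<open>\<tau>\<close> is admissible, and \<open>t\<close> exceeds all \<open>t - \<epsilon>\<close>\<close>
  define \<tau> where "\<tau> = (if K = 0 then t else (\<alpha> - 1) / K)"
  have \<tau>: "\<tau> > 0" "K * \<tau> \<le> \<alpha> - 1" using t assms(3,7) by (auto simp: \<tau>_def)
  have shifted: "harnack \<alpha> c x t \<le> ?C * max (1 / (t - \<epsilon>)) (K / (\<alpha> - 1))" if \<epsilon>: "0 < \<epsilon>" "\<epsilon> < t" for \<epsilon>
  proof -
    let ?\<theta> = "min (t - \<epsilon>) \<tau>"
    have \<theta>: "?\<theta> > 0" using \<epsilon> \<tau> by simp
    have "?\<theta> * harnack \<alpha> c x t \<le> ?C"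
      by (rule weighted_harnack_bound[OF assms(2,4,7,3) \<tau> \<epsilon> c x])
    then have "harnack \<alpha> c x t \<le> ?C * (1 / ?\<theta>)" using \<theta> by (simp add: field_simps)
    also have "\<dots> \<le> ?C * max (1 / (t - \<epsilon>)) (K / (\<alpha> - 1))"
    proof (rule mult_left_mono)
      show "1 / ?\<theta> \<le> max (1 / (t - \<epsilon>)) (K / (\<alpha> - 1))"
        using \<epsilon> by (auto simp: min_def \<tau>_def)
    qed simp
    finally show ?thesis .
  qed
  have "((\<lambda>\<epsilon>. ?C * max (1 / (t - \<epsilon>)) (K / (\<alpha> - 1))) \<longlongrightarrow> ?C * max (1 / (t - 0)) (K / (\<alpha> - 1))) (at_right 0)"
    using t by (intro tendsto_intros) auto
  moreover have "\<forall>\<^sub>F \<epsilon> in at_right 0. harnack \<alpha> c x t \<le> ?C * max (1 / (t - \<epsilon>)) (K / (\<alpha> - 1))"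
    unfolding eventually_at_right[OF t] using t shifted by blast
  ultimately have "harnack \<alpha> c x t \<le> ?C * max (1 / (t - 0)) (K / (\<alpha> - 1))"
    by (rule tendsto_lowerbound) simp
  then show "grad_norm_sq g c (\<lambda>z. ln (u z t)) x - \<alpha> * deriv (\<lambda>s. ln (u x s)) t
      \<le> ?C * max (1 / t) (K / (\<alpha> - 1))"
    by (simp add: harnack_def)
qed

end
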